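(* Let $\mathcal{G}$ be a group prevariety over a finite alphabet $A$ and $\rho:2^{A^*}\to R$ a nice multiplicative rating map. Let $\tau:2^{A^*}\to 2^R$ be the map $K\mapsto\mathcal{I}_{\mathit{SF}(\mathcal{G})}[K,\rho]$. Then $\iota_{\mathcal{G}}[\tau]$ is the least subset of $R$ that is $\mathit{SF}$-complete for $\mathcal{G}$ and $\rho$.
   Context: Fix a finite alphabet $A$. A lattice is a class of languages containing $\emptyset,A^*$, closed under union and intersection. A prevariety is a lattice of regular languages closed under complement and quotients $u^{-1}L=\{w\mid uw\in L\}$, $Lu^{-1}=\{w\mid wu\in L\}$. A group prevariety is a prevariety whose languages are all recognized by morphisms into finite groups. $\mathit{SF}(\mathcal{G})$ is the least class containing $\mathcal{G}$ and all $\{a\}$ ($a\in A$), closed under union, complement and concatenation. A rating algebra is a finite commutative idempotent monoid $(Q,+)$ (neutral element $0_Q$), ordered by $q\le r$ iff $q+r=r$. A rating map is $\tau:2^{A^*}\to Q$ with $\tau(\emptyset)=0_Q$ and $\tau(K_1\cup K_2)=\tau(K_1)+\tau(K_2)$. It is nice if every $K$ has a finite subset $F$ with $\tau(K)=\tau(F)$. It is multiplicative if $Q$ has a multiplication making $(Q,+,\cdot)$ an idempotent semiring and $\tau(\{\varepsilon\})=1_Q$, $\tau(K_1K_2)=\tau(K_1)\tau(K_2)$. Write $\tau(w)=\tau(\{w\})$. In $R$, $\omega$ is a positive integer such that $r^\omega$ is idempotent for every $r$. For a lattice $\mathcal{D}$, a language $L$ and a rating map $\rho$: a $\mathcal{D}$-cover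 of $L$ is a finite set $\mathbf{K}\subseteq\mathcal{D}$ with $L\subseteq\bigcup\mathbf{K}$; its $\rho$-imprint is $\{r\mid\exists K\in\mathbf{K}, r\le\rho(K)\}$; there exists a $\mathcal{D}$-cover of $L$ whose imprint is included in the imprint of every $\mathcal{D}$-cover of $L$, and this imprint is denoted $\mathcal{I}_{\mathcal{D}}[L,\rho]$. The map $\tau$ above is a rating map into $(2^R,\cup)$, ordered by inclusion. For a lattice $\mathcal{G}$ and rating map $\tau:2^{A^*}\to Q$, a $\mathcal{G}$-identity is a language $L\in\mathcal{G}$ with $\varepsilon\in L$; there exists a $\mathcal{G}$-identity $L$ with $\tau(L)\le\tau(L')$ for every $\mathcal{G}$-identity $L'$, and $\iota_{\mathcal{G}}[\tau]$ denotes $\tau(L)$ for any such $L$. For $S\subseteq R$, let $\mu_{\rho,S}:2^{A^*}\to 2^R$ be the nice multiplicative rating map into the idempotent semiring $(2^R,\cup,\cdot)$ (with $XY=\{xy\mid x\in X,y\in Y\}$) determined by $\mu_{\rho,S}(a)=\{s\rho(a)s'\mid s,s'\in S\}$ for $a\in A$; that is, $\mu_{\rho,S}(\varepsilon)=\{1_R\}$, $\mu_{\rho,S}(a_1\cdots a_n)=\mu_{\rho,S}(a_1)\cdots\mu_{\rho,S}(a_n)$ and $\mu_{\rho,S}(K)=\bigcup_{w\in K}\mu_{\rho,S}(w)$. A set $S\subseteq R$ is $\mathit{SF}$-complete for $\mathcal{G}$ and $\rho$ if: (1) $r\in S$ and $q\le r$ imply $q\in S$; (2) $q,r\in S$ imply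 $qr\in S$; (3) $\iota_{\mathcal{G}}[\mu_{\rho,S}]\subseteq S$; (4) $r\in S$ implies $r^\omega+r^{\omega+1}\in S$. *)

theory Defs
  imports "HOL-Algebra.Group"
begin

definition lconc :: "'a list set \<Rightarrow> 'a list set \<Rightarrow> 'a list set" where
  "lconc K1 K2 = {u @ v | u v. u \<in> K1 \<and> v \<in> K2}"

inductive_set lstar :: "'a list set \<Rightarrow> 'a list set" for K where
  lstar_nil: "[] \<in> lstar K"
| lstar_app: "u \<in> K \<Longrightarrow> v \<in> lstar K \<Longrightarrow> u @ v \<in> lstar K"

inductive regular :: "'a list set \<Rightarrow> bool" where
  reg_empty: "regular {}"
| reg_eps: "regular {[]}"
| reg_letter: "regular {[a]}"
| reg_union: "regular K1 \<Longrightarrow> regular K2 \<Longrightarrow> regular (K1 \<union> K2)"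
| reg_conc: "regular K1 \<Longrightarrow> regular K2 \<Longrightarrow> regular (lconc K1 K2)"
| reg_star: "regular K \<Longrightarrow> regular (lstar K)"

definition lquot :: "'a list \<Rightarrow> 'a list set \<Rightarrow> 'a list set" where
  "lquot u L = {w. u @ w \<in> L}"

definition rquot :: "'a list set \<Rightarrow> 'a list \<Rightarrow> 'a list set" where
  "rquot L u = {w. w @ u \<in> L}"

definition lang_lattice :: "'a list set set \<Rightarrow> bool" where
  "lang_lattice D \<longleftrightarrow> {} \<in> D \<and> UNIV \<in> D \<and>
     (\<forall>K1\<in>D. \<forall>K2\<in>D. K1 \<union> K2 \<in> D \<and> K1 \<inter> K2 \<in> D)"

definition prevariety :: "'a list set set \<Rightarrow> bool" where
  "prevariety C \<longleftrightarrow> lang_lattice C \<and> (\<forall>L\<in>C. regular L) \<and>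
     (\<forall>L\<in>C. UNIV - L \<in> C) \<and>
     (\<forall>L\<in>C. \<forall>u. lquot u L \<in> C \<and> rquot L u \<in> C)"

text \<open>Recognition by a monoid morphism into a finite group. Every finite group is
  isomorphic to one whose carrier is a set of natural numbers, so we take groups over nat.\<close>
definition group_recognized :: "'a list set \<Rightarrow> bool" where
  "group_recognized L \<longleftrightarrow>
     (\<exists>(G :: nat monoid) (h :: 'a list \<Rightarrow> nat).
        group G \<and> finite (carrier G) \<and> (\<forall>w. h w \<in> carrier G) \<and>
        h [] = \<one>\<^bsub>G\<^esub> \<and> (\<forall>u v. h (u @ v) = h u \<otimes>\<^bsub>G\<^esub> h v) \<and>
        (\<forall>u v. h u = h v \<longrightarrow> (u \<in> L \<longleftrightarrow> v \<in> L)))"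

definition group_prevariety :: "'a list set set \<Rightarrow> bool" where
  "group_prevariety G \<longleftrightarrow> prevariety G \<and> (\<forall>L\<in>G. group_recognized L)"

inductive_set SF :: "'a list set set \<Rightarrow> 'a list set set" for G where
  SF_base: "L \<in> G \<Longrightarrow> L \<in> SF G"
| SF_letter: "{[a]} \<in> SF G"
| SF_union: "K1 \<in> SF G \<Longrightarrow> K2 \<in> SF G \<Longrightarrow> K1 \<union> K2 \<in> SF G"
| SF_compl: "K \<in> SF G \<Longrightarrow> UNIV - K \<in> SF G"
| SF_conc: "K1 \<in> SF G \<Longrightarrow> K2 \<in> SF G \<Longrightarrow> lconc K1 K2 \<in> SF G"

definition idem_semiring ::
  "('r \<Rightarrow> 'r \<Rightarrow> 'r) \<Rightarrow> 'r \<Rightarrow> ('r \<Rightarrow> 'r \<Rightarrow> 'r) \<Rightarrow> 'r \<Rightarrow> bool" where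
  "idem_semiring pl z tm e \<longleftrightarrow>
     (\<forall>x y w. pl (pl x y) w = pl x (pl y w)) \<and> (\<forall>x y. pl x y = pl y x) \<and>
     (\<forall>x. pl z x = x) \<and> (\<forall>x. pl x x = x) \<and>
     (\<forall>x y w. tm (tm x y) w = tm x (tm y w)) \<and>
     (\<forall>x. tm e x = x \<and> tm x e = x) \<and>
     (\<forall>x y w. tm x (pl y w) = pl (tm x y) (tm x w)) \<and>
     (\<forall>x y w. tm (pl y w) x = pl (tm y x) (tm w x)) \<and>
     (\<forall>x. tm z x = z \<and> tm x z = z)"

definition rle :: "('r \<Rightarrow> 'r \<Rightarrow> 'r) \<Rightarrow> 'r \<Rightarrow> 'r \<Rightarrow> bool" where
  "rle pl q r \<longleftrightarrow> pl q r = r"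

definition rating_map ::
  "('r \<Rightarrow> 'r \<Rightarrow> 'r) \<Rightarrow> 'r \<Rightarrow> ('a list set \<Rightarrow> 'r) \<Rightarrow> bool" where
  "rating_map pl z \<rho> \<longleftrightarrow> \<rho> {} = z \<and> (\<forall>K1 K2. \<rho> (K1 \<union> K2) = pl (\<rho> K1) (\<rho> K2))"

definition nice :: "('a list set \<Rightarrow> 'r) \<Rightarrow> bool" where
  "nice \<rho> \<longleftrightarrow> (\<forall>K. \<exists>F. F \<subseteq> K \<and> finite F \<and> \<rho> K = \<rho> F)"

definition multiplicative ::
  "('r \<Rightarrow> 'r \<Rightarrow> 'r) \<Rightarrow> 'r \<Rightarrow> ('a list set \<Rightarrow> 'r) \<Rightarrow> bool" where
  "multiplicative tm e \<rho> \<longleftrightarrow> \<rho> {[]} = e \<and>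
     (\<forall>K1 K2. \<rho> (lconc K1 K2) = tm (\<rho> K1) (\<rho> K2))"

definition rpow :: "('r \<Rightarrow> 'r \<Rightarrow> 'r) \<Rightarrow> 'r \<Rightarrow> 'r \<Rightarrow> nat \<Rightarrow> 'r" where
  "rpow tm e r n = ((tm r) ^^ n) e"

definition is_cover :: "'a list set set \<Rightarrow> 'a list set \<Rightarrow> 'a list set set \<Rightarrow> bool" where
  "is_cover D L KK \<longleftrightarrow> finite KK \<and> KK \<subseteq> D \<and> L \<subseteq> \<Union>KK"

definition imprint ::
  "('r \<Rightarrow> 'r \<Rightarrow> 'r) \<Rightarrow> ('a list set \<Rightarrow> 'r) \<Rightarrow> 'a list set set \<Rightarrow> 'r set" where
  "imprint pl \<rho> KK = {r. \<exists>K\<in>KK. rle pl r (\<rho> K)}"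

definition opt_imprint ::
  "'a list set set \<Rightarrow> ('r \<Rightarrow> 'r \<Rightarrow> 'r) \<Rightarrow> 'a list set \<Rightarrow> ('a list set \<Rightarrow> 'r) \<Rightarrow> 'r set" where
  "opt_imprint D pl L \<rho> = (THE P. \<exists>KK. is_cover D L KK \<and> P = imprint pl \<rho> KK \<and>
       (\<forall>KK'. is_cover D L KK' \<longrightarrow> P \<subseteq> imprint pl \<rho> KK'))"

definition iota :: "'a list set set \<Rightarrow> ('a list set \<Rightarrow> 'r set) \<Rightarrow> 'r set" where
  "iota G \<tau> = (THE q. \<exists>L\<in>G. [] \<in> L \<and> q = \<tau> L \<and>
       (\<forall>L'\<in>G. [] \<in> L' \<longrightarrow> \<tau> L \<subseteq> \<tau> L'))"

definition setprod :: "('r \<Rightarrow> 'r \<Rightarrow> 'r) \<Rightarrow> 'r set \<Rightarrow> 'r set \<Rightarrow> 'r set" where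
  "setprod tm X Y = {tm x y | x y. x \<in> X \<and> y \<in> Y}"

definition mu_letter ::
  "('r \<Rightarrow> 'r \<Rightarrow> 'r) \<Rightarrow> ('a list set \<Rightarrow> 'r) \<Rightarrow> 'r set \<Rightarrow> 'a \<Rightarrow> 'r set" where
  "mu_letter tm \<rho> S a = {tm (tm s (\<rho> {[a]})) s' | s s'. s \<in> S \<and> s' \<in> S}"

fun mu_word ::
  "('r \<Rightarrow> 'r \<Rightarrow> 'r) \<Rightarrow> 'r \<Rightarrow> ('a list set \<Rightarrow> 'r) \<Rightarrow> 'r set \<Rightarrow> 'a list \<Rightarrow> 'r set" where
  "mu_word tm e \<rho> S [] = {e}"
| "mu_word tm e \<rho> S (a # w) = setprod tm (mu_letter tm \<rho> S a) (mu_word tm e \<rho> S w)"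

definition mu ::
  "('r \<Rightarrow> 'r \<Rightarrow> 'r) \<Rightarrow> 'r \<Rightarrow> ('a list set \<Rightarrow> 'r) \<Rightarrow> 'r set \<Rightarrow> 'a list set \<Rightarrow> 'r set" where
  "mu tm e \<rho> S K = (\<Union>w\<in>K. mu_word tm e \<rho> S w)"

definition SF_complete ::
  "'a list set set \<Rightarrow> ('r \<Rightarrow> 'r \<Rightarrow> 'r) \<Rightarrow> ('r \<Rightarrow> 'r \<Rightarrow> 'r) \<Rightarrow> 'r \<Rightarrow> nat
     \<Rightarrow> ('a list set \<Rightarrow> 'r) \<Rightarrow> 'r set \<Rightarrow> bool" where
  "SF_complete G pl tm e \<omega> \<rho> S \<longleftrightarrow>
     (\<forall>r\<in>S. \<forall>q. rle pl q r \<longrightarrow> q \<in> S) \<and>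
     (\<forall>q\<in>S. \<forall>r\<in>S. tm q r \<in> S) \<and>
     iota G (mu tm e \<rho> S) \<subseteq> S \<and>
     (\<forall>r\<in>S. pl (rpow tm e r \<omega>) (rpow tm e r (\<omega> + 1)) \<in> S)"

end

theory Submission
  imports Defs "HOL-Algebra.Multiplicative_Group"
begin

text \<open>
  An imprint element of a language \<open>K\<close> is witnessed, for each finite set of \<open>SF(G)\<close> languages, by a
  syntactic class of a word of \<open>K\<close>. Together with the fact that \<open>SF(G)\<close> languages are
  aperiodic on the words of a suitable \<open>G\<close>-identity, this shows that \<open>\<iota>\<^sub>G[\<tau>]\<close> is \<open>SF\<close>-complete.

  For minimality, let \<open>S\<close> be \<open>SF\<close>-complete and take the kernel of a finite group quotient on which
  \<open>\<mu>\<close> stays in \<open>S\<close>. Its words are loops in the Cayley graph. A loop at a vertex is a product of first returns,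
  and each first return is a simple cycle decorated at its vertices with loops that avoid the vertices
  already visited; so induction on the number of available vertices covers the first returns by \<open>SF(G)\<close> languages
  rated in \<open>S\<close>. The first returns form a prefix code whose star is again in \<open>SF(G)\<close>, and the
  star is covered by a Wilke-style induction in which closure of \<open>S\<close> under \<open>r\<^sup>\<omega> + r\<^sup>\<omega>\<^sup>+\<^sup>1\<close> handles the case where
  all blocks act as permutations.
\<close>

section \<open>Languages\<close>

lemma lconcI: "u \<in> K1 \<Longrightarrow> v \<in> K2 \<Longrightarrow> u @ v \<in> lconc K1 K2"
  by (auto simp: lconc_def)

lemma lconcE:
  assumes "w \<in> lconc K1 K2"
  obtains u v where "w = u @ v" "u \<in> K1" "v \<in> K2"
  using assms by (auto simp: lconc_def)

lemma lconc_mono: "K1 \<subseteq> K1' \<Longrightarrow> K2 \<subseteq> K2' \<Longrightarrow> lconc K1 K2 \<subseteq> lconc K1' K2'"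
  by (auto simp: lconc_def)

lemma lstar_append: "u \<in> lstar K \<Longrightarrow> v \<in> lstar K \<Longrightarrow> u @ v \<in> lstar K"
  by (induction rule: lstar.induct) (auto intro: lstar.intros)

lemma lstar_single: "u \<in> K \<Longrightarrow> u \<in> lstar K"
  using lstar_app[of u K "[]"] lstar_nil by auto

lemma lstar_mono:
  assumes "K \<subseteq> K'" shows "lstar K \<subseteq> lstar K'"
proof
  fix w assume "w \<in> lstar K"
  then show "w \<in> lstar K'"
    by induction (use assms in \<open>auto intro: lstar.intros\<close>)
qed

section \<open>Powers of words\<close>

abbreviation wpow :: "'a list \<Rightarrow> nat \<Rightarrow> 'a list" where
  "wpow w n \<equiv> concat (replicate n w)"

lemma wpow_add: "wpow w (m + n) = wpow w m @ wpow w n"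
  by (simp add: replicate_add)

lemma wpow_Suc_right: "wpow w (Suc n) = wpow w n @ w"
  using wpow_add[of n 1 w] by simp

text \<open>A cut of a power falls into one copy of \<open>w\<close> and leaves whole copies on both
  sides. Counting these drives the concatenation case of aperiodicity.\<close>

lemma wpow_split:
  "wpow w n = u @ v \<longleftrightarrow> n = 0 \<and> u = [] \<and> v = [] \<or>
     (\<exists>i j w1 w2. n = Suc (i + j) \<and> w = w1 @ w2 \<and> u = wpow w i @ w1 \<and> v = w2 @ wpow w j)"
  (is "_ \<longleftrightarrow> _ \<or> ?R n u")
proof
  show "wpow w n = u @ v \<Longrightarrow> n = 0 \<and> u = [] \<and> v = [] \<or> ?R n u"
  proof (induction n arbitrary: u)
    case (Suc n)
    have eq: "w @ wpow w n = u @ v" using Suc.prems by simp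
    from eq consider u' where "u = w @ u'" "wpow w n = u' @ v"
      | w2 where "w = u @ w2" "v = w2 @ wpow w n"
      unfolding append_eq_append_conv2 by metis
    then show ?case
    proof cases
      case 1
      from Suc.IH[OF 1(2)] show ?thesis
      proof
        assume "n = 0 \<and> u' = [] \<and> v = []"
        then show ?thesis using 1
          by (intro disjI2 exI[of _ 0] exI[of _ 0] exI[of _ w] exI[of _ "[]"]) simp
      next
        assume "?R n u'"
        then obtain i j w1 w2 where "n = Suc (i + j)" "w = w1 @ w2" "u' = wpow w i @ w1" "v = w2 @ wpow w j"
          by blast
        then show ?thesis using 1
          by (intro disjI2 exI[of _ "Suc i"] exI[of _ j] exI[of _ w1] exI[of _ w2]) simp
      qed
    next
      case 2
      then show ?thesis by (intro disjI2 exI[of _ 0] exI[of _ n] exI[of _ u] exI[of _ w2]) simp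
    qed
  qed simp
  assume "n = 0 \<and> u = [] \<and> v = [] \<or> ?R n u"
  then show "wpow w n = u @ v"
  proof
    assume "?R n u"
    then obtain i j w1 w2 where *: "n = Suc (i + j)" "w = w1 @ w2" "u = wpow w i @ w1" "v = w2 @ wpow w j"
      by blast
    have "wpow w n = wpow w i @ w @ wpow w j" using *(1) wpow_add[of i "Suc j" w] by simp
    then show ?thesis using * by simp
  qed simp
qed

section \<open>Two-sided quotients\<close>

definition bquot :: "'a list \<Rightarrow> 'a list \<Rightarrow> 'a list set \<Rightarrow> 'a list set" where
  "bquot x y L = {w. x @ w @ y \<in> L}"

definition bquots :: "'a list set \<Rightarrow> 'a list set set" where
  "bquots L = {bquot x y L | x y. True}"

lemma mem_bquot [simp]: "w \<in> bquot x y L \<longleftrightarrow> x @ w @ y \<in> L"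
  by (simp add: bquot_def)

lemma bquot_in_bquots [simp]: "bquot x y L \<in> bquots L"
  by (auto simp: bquots_def)

text \<open>The cut between the two factors falls into \<open>w\<close>, into \<open>x\<close> or
  into \<open>y\<close>. The last two cases give unions of quotients of a single factor, so finitely
  many quotients of the factors leave only finitely many results.\<close>

lemma bquot_lconc:
  "bquot x y (lconc K1 K2) = lconc (bquot x [] K1) (bquot [] y K2)
     \<union> \<Union>{bquot x2 y K2 | x1 x2. x = x1 @ x2 \<and> x1 \<in> K1}
     \<union> \<Union>{bquot x y1 K1 | y1 y2. y = y1 @ y2 \<and> y2 \<in> K2}" (is "?L = ?A \<union> ?B \<union> ?C")
proof
  show "?L \<subseteq> ?A \<union> ?B \<union> ?C"
  proof
    fix w assume "w \<in> ?L"
    then obtain u v where uv: "x @ w @ y = u @ v" "u \<in> K1" "v \<in> K2"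
      by (auto elim: lconcE)
    from uv(1) consider
        (1) x2 where "x = u @ x2" "v = x2 @ w @ y"
      | (2) us where "u = x @ us" "w @ y = us @ v"
      unfolding append_eq_append_conv2 by metis
    then show "w \<in> ?A \<union> ?B \<union> ?C"
    proof cases
      case 1
      then have "w \<in> bquot x2 y K2" using uv(3) by simp
      then have "w \<in> ?B" using 1(1) uv(2) by blast
      then show ?thesis by simp
    next
      case 2
      obtain t where "w = us @ t \<and> t @ y = v \<or> w @ t = us \<and> y = t @ v"
        using 2(2) unfolding append_eq_append_conv2 by blast
      then show ?thesis
      proof
        assume t: "w = us @ t \<and> t @ y = v"
        then have "us @ t \<in> ?A" using uv 2(1) by (intro lconcI) auto
        then show ?thesis using t by simp
      next
        assume t: "w @ t = us \<and> y = t @ v"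
        then have "w \<in> bquot x t K1" using uv 2(1) by simp
        then have "w \<in> ?C" using t uv(3) by blast
        then show ?thesis by simp
      qed
    qed
  qed
  have "?A \<subseteq> ?L"
  proof
    fix w assume "w \<in> ?A"
    then obtain u v where "w = u @ v" "x @ u \<in> K1" "v @ y \<in> K2"
      by (auto elim: lconcE)
    then show "w \<in> ?L" using lconcI[of "x @ u" K1 "v @ y" K2] by simp
  qed
  moreover have "?B \<subseteq> ?L" by (auto intro: lconcI)
  moreover have "?C \<subseteq> ?L"
  proof -
    have "x @ w @ y1 @ y2 \<in> lconc K1 K2" if "x @ w @ y1 \<in> K1" "y2 \<in> K2" for w y1 y2
      using lconcI[OF that] by simp
    then show ?thesis by auto
  qed
  ultimately show "?A \<union> ?B \<union> ?C \<subseteq> ?L" by blast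
qed

text \<open>Schuetzenberger's aperiodicity, demanded only of the words of \<open>L\<close>: a group
  language has it on the kernel of its group, though in general not on all words.\<close>

definition aperiodic_on :: "'a list set \<Rightarrow> nat \<Rightarrow> 'a list set \<Rightarrow> bool" where
  "aperiodic_on L k H \<longleftrightarrow>
     (\<forall>w\<in>L. \<forall>n\<ge>k. \<forall>x y. x @ wpow w n @ y \<in> H \<longleftrightarrow> x @ wpow w (Suc n) @ y \<in> H)"

lemma aperiodic_onI:
  "(\<And>w n x y. w \<in> L \<Longrightarrow> n \<ge> k \<Longrightarrow> x @ wpow w n @ y \<in> H \<longleftrightarrow> x @ wpow w (Suc n) @ y \<in> H) \<Longrightarrow> aperiodic_on L k H"
  unfolding aperiodic_on_def by blast

lemma aperiodic_onD:
  "aperiodic_on L k H \<Longrightarrow> w \<in> L \<Longrightarrow> n \<ge> k \<Longrightarrow> x @ wpow w n @ y \<in> H \<longleftrightarrow> x @ wpow w (Suc n) @ y \<in> H"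
  unfolding aperiodic_on_def by blast

lemma aperiodic_on_mono: "aperiodic_on L k H \<Longrightarrow> L' \<subseteq> L \<Longrightarrow> k \<le> k' \<Longrightarrow> aperiodic_on L' k' H"
  unfolding aperiodic_on_def by (meson dual_order.trans subsetD)

lemma aperiodic_onD':
  assumes "aperiodic_on L k H" "w \<in> L" "n \<ge> k" "n' \<ge> k" "x @ wpow w n @ y \<in> H"
  shows "x @ wpow w n' @ y \<in> H"
proof -
  have "x @ wpow w m @ y \<in> H \<longleftrightarrow> x @ wpow w k @ y \<in> H" if "m \<ge> k" for m
    using that
  proof (induction m rule: dec_induct)
    case (step m)
    then show ?case using aperiodic_onD[OF assms(1,2) step.hyps(1)] by blast
  qed simp
  from this[OF assms(3)] this[OF assms(4)] assms(5) show ?thesis by blast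
qed

text \<open>Besides the copy of \<open>w\<close> that contains the cut, at least
  \<open>k1 + k2\<close> copies remain, so the left part has at least \<open>k1\<close> of them or
  the right part at least \<open>k2\<close>, and there a copy can be added. A copy can also be
  removed, because the smaller exponent still meets the threshold and so one copy is to
  spare.\<close>

lemma aperiodic_on_lconc:
  assumes ap: "aperiodic_on L k1 K1" "aperiodic_on L k2 K2"
  shows "aperiodic_on L (Suc (k1 + k2)) (lconc K1 K2)"
proof -
  \<comment> \<open>\<open>n\<close> and \<open>n'\<close> are neighbours in either order, so this
    one implication yields both directions of the equivalence.\<close>
  have *: "x @ wpow w n' @ y \<in> lconc K1 K2"
    if w: "w \<in> L" and n: "n \<ge> Suc (k1 + k2)" "n' \<ge> Suc (k1 + k2)" "n' = Suc n \<or> n = Suc n'"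
      and mem: "x @ wpow w n @ y \<in> lconc K1 K2" for w x y n n'
  proof -
    have sh1: "x @ wpow w i @ y \<in> K1 \<Longrightarrow> i' = i \<or> i \<ge> k1 \<and> i' \<ge> k1 \<Longrightarrow> x @ wpow w i' @ y \<in> K1" for x y i i'
      using aperiodic_onD'[OF ap(1) w, of i i'] by blast
    have sh2: "x @ wpow w i @ y \<in> K2 \<Longrightarrow> i' = i \<or> i \<ge> k2 \<and> i' \<ge> k2 \<Longrightarrow> x @ wpow w i' @ y \<in> K2" for x y i i'
      using aperiodic_onD'[OF ap(2) w, of i i'] by blast
    obtain u v where uv: "x @ (wpow w n @ y) = u @ v" "u \<in> K1" "v \<in> K2" using mem by (metis lconcE)
    then consider (x) t where "x = u @ t" "v = t @ wpow w n @ y"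
      | (wy) t where "u = x @ t" "wpow w n @ y = t @ v"
      unfolding append_eq_append_conv2 by metis
    then show ?thesis
    proof cases
      case x
      then have "t @ wpow w n' @ y \<in> K2" using sh2[of t n y n'] uv(3) n by force
      then show ?thesis using lconcI[OF uv(2)] x by simp
    next
      case wy
      from wy(2) consider (y) s where "t = wpow w n @ s" "y = s @ v"
        | (w) s where "wpow w n = t @ s" "v = s @ y"
        unfolding append_eq_append_conv2 by metis
      then show ?thesis
      proof cases
        case y
        then have "x @ wpow w n' @ s \<in> K1" using sh1[of x n s n'] uv(2) wy n by force
        from lconcI[OF this uv(3)] show ?thesis using y by simp
      next
        case w
        from w(1) n(1) obtain i j w1 w2 where
          ij: "n = Suc (i + j)" "w = w1 @ w2" "t = wpow w i @ w1" "s = w2 @ wpow w j"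
          unfolding wpow_split by auto
        have "\<exists>i' j'. n' = Suc (i' + j') \<and> (i' = i \<or> i \<ge> k1 \<and> i' \<ge> k1) \<and> (j' = j \<or> j \<ge> k2 \<and> j' \<ge> k2)"
        proof (cases "n' = Suc n")
          case True
          show ?thesis
          proof (cases "i \<ge> k1")
            case i: True
            show ?thesis by (rule exI[of _ "Suc i"], rule exI[of _ j]) (use i True ij(1) in simp)
          next
            case i: False
            show ?thesis by (rule exI[of _ i], rule exI[of _ "Suc j"]) (use i True ij(1) n(1) in simp)
          qed
        next
          case False
          then have n: "n = Suc n'" "n' \<ge> Suc (k1 + k2)" using n by auto
          show ?thesis
          proof (cases "i \<ge> Suc k1")
            case i: True
            show ?thesis by (rule exI[of _ "i - 1"], rule exI[of _ j]) (use i n ij(1) in force)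
          next
            case i: False
            show ?thesis by (rule exI[of _ i], rule exI[of _ "j - 1"]) (use i n ij(1) in force)
          qed
        qed
        then obtain i' j' where ij': "n' = Suc (i' + j')" "i' = i \<or> i \<ge> k1 \<and> i' \<ge> k1"
          "j' = j \<or> j \<ge> k2 \<and> j' \<ge> k2" by blast
        have "x @ wpow w i' @ w1 \<in> K1" using sh1[OF _ ij'(2)] uv(2) wy(1) ij(3) by simp
        moreover have "w2 @ wpow w j' @ y \<in> K2" using sh2[OF _ ij'(3)] uv(3) w(2) ij(4) by simp
        ultimately have "(x @ wpow w i' @ w1) @ (w2 @ wpow w j' @ y) \<in> lconc K1 K2" by (rule lconcI)
        moreover have "wpow w n' = wpow w i' @ w @ wpow w j'"
          using ij'(1) wpow_add[of i' "Suc j'" w] by simp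
        ultimately show ?thesis using ij(2) by simp
      qed
    qed
  qed
  show ?thesis by (rule aperiodic_onI) (meson * le_SucI)
qed

text \<open>The class of \<open>w\<close> under the coarsest congruence that saturates every
  language of \<open>KK\<close>.\<close>

definition syn :: "'a list set set \<Rightarrow> 'a list \<Rightarrow> 'a list set" where
  "syn KK w = {v. \<forall>K\<in>KK. \<forall>x y. x @ v @ y \<in> K \<longleftrightarrow> x @ w @ y \<in> K}"

lemma syn_refl [simp]: "w \<in> syn KK w"
  by (simp add: syn_def)

lemma syn_eq_iff: "syn KK v = syn KK w \<longleftrightarrow> v \<in> syn KK w"
  by (auto simp: syn_def)

lemma syn_append:
  assumes "u \<in> syn KK u'" "v \<in> syn KK v'"
  shows "u @ v \<in> syn KK (u' @ v')"
  unfolding syn_def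
proof (clarify)
  fix K x y assume K: "K \<in> KK"
  have "x @ u @ (v @ y) \<in> K \<longleftrightarrow> x @ u' @ (v @ y) \<in> K"
    using assms(1) K unfolding syn_def by blast
  moreover have "(x @ u') @ v @ y \<in> K \<longleftrightarrow> (x @ u') @ v' @ y \<in> K"
    using assms(2) K unfolding syn_def by blast
  ultimately show "x @ (u @ v) @ y \<in> K \<longleftrightarrow> x @ (u' @ v') @ y \<in> K" by simp
qed

lemma syn_append_eq:
  "syn KK u = syn KK u' \<Longrightarrow> syn KK v = syn KK v' \<Longrightarrow> syn KK (u @ v) = syn KK (u' @ v')"
  by (simp add: syn_eq_iff syn_append)

lemma syn_subset:
  assumes "K \<in> KK" "w \<in> K" shows "syn KK w \<subseteq> K"
proof
  fix v assume "v \<in> syn KK w"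
  then have "[] @ v @ [] \<in> K \<longleftrightarrow> [] @ w @ [] \<in> K" using assms(1) unfolding syn_def by blast
  then show "v \<in> K" using assms(2) by simp
qed

lemma lconc_syn: "lconc (syn KK u) (syn KK v) \<subseteq> syn KK (u @ v)"
  by (auto elim!: lconcE intro: syn_append)

section \<open>Syntactic classes in a Boolean algebra of languages\<close>

definition bool_algebra :: "'a list set set \<Rightarrow> bool" where
  "bool_algebra C \<longleftrightarrow> UNIV \<in> C \<and> (\<forall>K\<in>C. UNIV - K \<in> C) \<and> (\<forall>K1\<in>C. \<forall>K2\<in>C. K1 \<union> K2 \<in> C)"

context
  fixes C :: "'a list set set"
  assumes C: "bool_algebra C"
begin

lemma ba_UNIV: "UNIV \<in> C" and ba_compl: "K \<in> C \<Longrightarrow> UNIV - K \<in> C"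
  and ba_Un: "K1 \<in> C \<Longrightarrow> K2 \<in> C \<Longrightarrow> K1 \<union> K2 \<in> C"
  using C by (auto simp: bool_algebra_def)

lemma ba_empty: "{} \<in> C"
  using ba_compl[OF ba_UNIV] by simp

lemma ba_Int: assumes "K1 \<in> C" "K2 \<in> C" shows "K1 \<inter> K2 \<in> C"
proof -
  have "K1 \<inter> K2 = UNIV - ((UNIV - K1) \<union> (UNIV - K2))" by blast
  then show ?thesis using assms by (metis ba_Un ba_compl)
qed

lemma ba_Diff: assumes "K1 \<in> C" "K2 \<in> C" shows "K1 - K2 \<in> C"
proof -
  have "K1 - K2 = K1 \<inter> (UNIV - K2)" by blast
  then show ?thesis using assms by (metis ba_Int ba_compl)
qed

lemma ba_Union: "finite KK \<Longrightarrow> KK \<subseteq> C \<Longrightarrow> \<Union>KK \<in> C"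
  by (induction rule: finite_induct) (auto intro: ba_Un ba_empty)

lemma ba_Inter: "finite KK \<Longrightarrow> KK \<subseteq> C \<Longrightarrow> \<Inter>KK \<in> C"
  by (induction rule: finite_induct) (auto intro: ba_Int ba_UNIV)

text \<open>A class is determined by which of the finitely many two-sided quotients contain its
  words. So it is a Boolean combination of them, and there are finitely many classes. The result
  serves \<open>G\<close> and \<open>SF G\<close> alike.\<close>

lemma syn_in_ba:
  assumes "finite KK" "\<And>K. K \<in> KK \<Longrightarrow> bquots K \<subseteq> C \<and> finite (bquots K)"
  shows "syn KK w \<in> C" "finite (range (syn KK))"
proof -
  define D where "D = (\<Union>K\<in>KK. bquots K)"
  have fin: "finite D" and sub: "D \<subseteq> C" using assms by (auto simp: D_def)
  have mem: "v \<in> syn KK w \<longleftrightarrow> (\<forall>B\<in>D. v \<in> B \<longleftrightarrow> w \<in> B)" for v w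
  proof
    assume v: "v \<in> syn KK w"
    show "\<forall>B\<in>D. v \<in> B \<longleftrightarrow> w \<in> B"
    proof
      fix B assume "B \<in> D"
      then obtain K x y where "K \<in> KK" "B = bquot x y K" by (auto simp: D_def bquots_def)
      then show "v \<in> B \<longleftrightarrow> w \<in> B" using v by (simp add: syn_def)
    qed
  next
    assume v: "\<forall>B\<in>D. v \<in> B \<longleftrightarrow> w \<in> B"
    have "x @ v @ y \<in> K \<longleftrightarrow> x @ w @ y \<in> K" if "K \<in> KK" for K x y
    proof -
      have "bquot x y K \<in> D" unfolding D_def using that bquot_in_bquots by blast
      then have "v \<in> bquot x y K \<longleftrightarrow> w \<in> bquot x y K" using v by blast
      then show ?thesis by simp
    qed
    then show "v \<in> syn KK w" by (simp add: syn_def)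
  qed
  have eq: "syn KK w = (\<Inter>B\<in>D. if w \<in> B then B else UNIV - B)" for w
  proof (rule Set.set_eqI)
    fix v
    have "v \<in> (if w \<in> B then B else UNIV - B) \<longleftrightarrow> (v \<in> B \<longleftrightarrow> w \<in> B)" for B by simp
    then show "v \<in> syn KK w \<longleftrightarrow> v \<in> (\<Inter>B\<in>D. if w \<in> B then B else UNIV - B)"
      unfolding mem INT_iff by blast
  qed
  have "(\<lambda>B. if w \<in> B then B else UNIV - B) ` D \<subseteq> C"
    using sub by (auto intro: ba_compl)
  then show "syn KK w \<in> C" unfolding eq by (rule ba_Inter[OF finite_imageI[OF fin]])
  have "syn KK w = (\<lambda>E. {v. {B\<in>D. v \<in> B} = E}) {B\<in>D. w \<in> B}" for w
  proof (rule Set.set_eqI)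
    fix v
    have "{B\<in>D. v \<in> B} = {B\<in>D. w \<in> B} \<longleftrightarrow> (\<forall>B\<in>D. v \<in> B \<longleftrightarrow> w \<in> B)" by blast
    then show "v \<in> syn KK w \<longleftrightarrow> v \<in> (\<lambda>E. {v. {B\<in>D. v \<in> B} = E}) {B\<in>D. w \<in> B}" by (simp add: mem)
  qed
  then have "range (syn KK) \<subseteq> (\<lambda>E. {v. {B\<in>D. v \<in> B} = E}) ` Pow D" by blast
  then show "finite (range (syn KK))" using fin by (meson finite_Pow_iff finite_imageI finite_subset)
qed

end

section \<open>The class SF(G)\<close>

locale group_based =
  fixes G :: "('a::finite) list set set"
  assumes G: "group_prevariety G"
begin

lemma G_ba: "bool_algebra G" and G_lattice: "lang_lattice G"
  using G by (auto simp: group_prevariety_def prevariety_def lang_lattice_def bool_algebra_def)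

lemma SF_ba: "bool_algebra (SF G)"
  using ba_UNIV[OF G_ba] by (auto simp: bool_algebra_def intro: SF.intros)

lemma SF_lattice: "lang_lattice (SF G)"
  using SF_ba by (auto simp: lang_lattice_def intro: ba_empty ba_UNIV ba_Un ba_Int)

text \<open>By Lagrange, the order of the recognizing group is an exponent that sends every word to
  the neutral element. A two-sided quotient depends only on the images of \<open>x\<close> and
  \<open>y\<close>, whence finiteness.\<close>

lemma G_word_power:
  assumes "L \<in> G"
  obtains n where "n > 0" "\<And>w. wpow w n \<in> syn {L} []" "finite (bquots L)"
proof -
  obtain H :: "nat monoid" and h where H: "group H" "finite (carrier H)" "\<And>w. h w \<in> carrier H"
    "h [] = \<one>\<^bsub>H\<^esub>" "\<And>u v. h (u @ v) = h u \<otimes>\<^bsub>H\<^esub> h v"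
    "\<And>u v. h u = h v \<Longrightarrow> u \<in> L \<longleftrightarrow> v \<in> L"
    using assms G unfolding group_prevariety_def group_recognized_def by metis
  interpret H: group H by fact
  have "h (wpow w n) = h w [^]\<^bsub>H\<^esub> n" for w n
  proof (induction n)
    case (Suc n)
    then show ?case unfolding H.nat_pow_Suc2[OF H(3)] using H(5) by simp
  qed (simp add: H)
  then have one: "h (wpow w (order H)) = h []" for w
    using H.pow_order_eq_1 H by simp
  have "wpow w (order H) \<in> syn {L} []" for w
  proof -
    have "h (x @ wpow w (order H) @ y) = h (x @ [] @ y)" for x y by (simp only: H(5) one)
    then show ?thesis unfolding syn_def using H(6) by blast
  qed
  moreover have "order H > 0" using H(2) H.order_gt_0_iff_finite by blast
  moreover have "finite (bquots L)"
  proof -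
    define f where "f = (\<lambda>(a, b). {w. \<exists>v\<in>L. h v = a \<otimes>\<^bsub>H\<^esub> h w \<otimes>\<^bsub>H\<^esub> b})"
    have "bquot x y L = f (h x, h y)" for x y
    proof -
      have eq: "h (x @ w @ y) = h x \<otimes>\<^bsub>H\<^esub> h w \<otimes>\<^bsub>H\<^esub> h y" for w
        using H(3) by (simp add: H(5) H.m_assoc)
      have "w \<in> bquot x y L \<longleftrightarrow> (\<exists>v\<in>L. h v = h (x @ w @ y))" for w
        unfolding mem_bquot using H(6)[of _ "x @ w @ y"] by metis
      then show ?thesis by (auto simp: f_def eq)
    qed
    then have "bquots L \<subseteq> f ` (carrier H \<times> carrier H)"
      using H(3) by (auto simp only: bquots_def)
    then show ?thesis using H(2) by (meson finite_SigmaI finite_imageI finite_subset)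
  qed
  ultimately show thesis using that by blast
qed

lemma G_bquots:
  assumes "L \<in> G" shows "bquots L \<subseteq> G \<and> finite (bquots L)"
proof -
  have "bquot x y L = lquot x (rquot L y)" for x y
    by (auto simp: bquot_def lquot_def rquot_def)
  then show ?thesis using assms G G_word_power[OF assms]
    by (auto simp: bquots_def group_prevariety_def prevariety_def)
qed

text \<open>The complement consists of the words with a first letter, a finite union over the
  alphabet.\<close>

lemma eps_SF: "{[]} \<in> SF G"
proof -
  have "{[]} = UNIV - (\<Union>a. lconc {[a]} UNIV)"
  proof -
    have "w \<in> (\<Union>a. lconc {[a]} UNIV)" if "w \<noteq> []" for w :: "'a list"
      using that by (cases w) (auto simp: lconc_def)
    then show ?thesis by (auto simp: lconc_def)
  qed
  moreover have "(\<Union>a. lconc {[a]} UNIV) \<in> SF G"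
    by (rule ba_Union[OF SF_ba]) (auto intro: SF.intros ba_UNIV[OF SF_ba])
  ultimately show ?thesis using SF_compl by metis
qed

text \<open>Finiteness is carried through the induction for the sake of concatenation: the unions
  over cuts then range over subsets of a finite set of quotients, which makes them finite unions and
  bounds their number.\<close>

lemma SF_bquots: "L \<in> SF G \<Longrightarrow> bquots L \<subseteq> SF G \<and> finite (bquots L)"
proof (induction rule: SF.induct)
  case (SF_base L)
  then show ?case using G_bquots by (meson SF.SF_base subset_eq)
next
  case (SF_letter a)
  have "bquot x y {[a]} \<in> {{}, {[]}, {[a]}}" for x y
    by (cases x; cases y) (auto simp: bquot_def append_eq_Cons_conv)
  then have "bquots {[a]} \<subseteq> {{}, {[]}, {[a]}}" by (auto simp: bquots_def)
  moreover have "{{}, {[]}, {[a]}} \<subseteq> SF G"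
    using eps_SF ba_empty[OF SF_ba] SF.SF_letter by auto
  ultimately show ?case by (meson finite.emptyI finite.insertI finite_subset order_trans)
next
  case (SF_union K1 K2)
  have "bquot x y (K1 \<union> K2) = bquot x y K1 \<union> bquot x y K2" for x y by auto
  then have "bquots (K1 \<union> K2) \<subseteq> (\<lambda>(A, B). A \<union> B) ` (bquots K1 \<times> bquots K2)"
    by (force simp: bquots_def)
  moreover have "(\<lambda>(A, B). A \<union> B) ` (bquots K1 \<times> bquots K2) \<subseteq> SF G"
    using SF_union by (auto intro: SF.SF_union)
  ultimately show ?case using SF_union by (meson finite_SigmaI finite_imageI finite_subset order_trans)
next
  case (SF_compl K)
  have "bquot x y (UNIV - K) = UNIV - bquot x y K" for x y by auto
  then have "bquots (UNIV - K) \<subseteq> (\<lambda>A. UNIV - A) ` bquots K"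
    by (force simp: bquots_def)
  moreover have "(\<lambda>A. UNIV - A) ` bquots K \<subseteq> SF G"
    using SF_compl by (auto intro: SF.SF_compl)
  ultimately show ?case using SF_compl by (meson finite_imageI finite_subset order_trans)
next
  case (SF_conc K1 K2)
  define f where "f = (\<lambda>(A, B, \<A>, \<B>). lconc A B \<union> \<Union>\<A> \<union> \<Union>\<B> :: 'a list set)"
  let ?D = "bquots K1 \<times> bquots K2 \<times> Pow (bquots K2) \<times> Pow (bquots K1)"
  have "bquot x y (lconc K1 K2) \<in> f ` ?D" for x y
  proof (rule image_eqI)
    show "bquot x y (lconc K1 K2) = f (bquot x [] K1, bquot [] y K2,
       {bquot x2 y K2 | x1 x2. x = x1 @ x2 \<and> x1 \<in> K1}, {bquot x y1 K1 | y1 y2. y = y1 @ y2 \<and> y2 \<in> K2})"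
      by (simp add: f_def bquot_lconc)
  qed auto
  then have "bquots (lconc K1 K2) \<subseteq> f ` ?D" by (auto simp: bquots_def)
  moreover have "f ` ?D \<subseteq> SF G"
  proof -
    have "f (A, B, \<A>, \<B>) \<in> SF G"
      if "A \<in> bquots K1" "B \<in> bquots K2" "\<A> \<subseteq> bquots K2" "\<B> \<subseteq> bquots K1" for A B \<A> \<B>
    proof -
      have "\<Union>\<A> \<in> SF G" "\<Union>\<B> \<in> SF G"
        using that SF_conc.IH by (meson ba_Union[OF SF_ba] finite_subset order_trans)+
      moreover have "lconc A B \<in> SF G" using that SF_conc.IH by (blast intro: SF.SF_conc)
      ultimately show ?thesis by (simp add: f_def SF.SF_union)
    qed
    then show ?thesis by auto
  qed
  moreover have "finite ?D" using SF_conc.IH by simp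
  ultimately show ?case by (meson finite_imageI finite_subset order_trans)
qed

lemma SF_syn:
  assumes "finite KK" "KK \<subseteq> SF G"
  shows "syn KK w \<in> SF G" "finite (range (syn KK))"
  using syn_in_ba[OF SF_ba assms(1)] SF_bquots assms(2) by blast+

lemma G_syn:
  assumes "L \<in> G"
  shows "syn {L} w \<in> G" "finite (range (syn {L}))"
  using syn_in_ba[OF G_ba, of "{L}"] G_bquots assms by simp_all

text \<open>The classes form a group, where cancellation holds. In the Cayley graph: a path that
  returns to its starting vertex reads a word of the class of \<open>[]\<close>.\<close>

lemma G_syn_cancel:
  assumes "L \<in> G" "syn {L} (p @ u) = syn {L} p"
  shows "u \<in> syn {L} []"
proof -
  obtain n where n: "n > 0" "wpow p n \<in> syn {L} []" using G_word_power[OF assms(1)] by metis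
  \<comment> \<open>A left inverse of \<open>p\<close> modulo the congruence.\<close>
  let ?q = "wpow p (n - 1)"
  have qp: "?q @ p = wpow p n" using n(1) wpow_Suc_right[of "n - 1" p] by simp
  have "syn {L} (?q @ p @ u) = syn {L} (?q @ p)" using assms(2) by (intro syn_append_eq) auto
  then have "syn {L} (?q @ p @ u) = syn {L} []" using n(2) qp syn_eq_iff by metis
  moreover have "syn {L} ((?q @ p) @ u) = syn {L} ([] @ u)"
    using n(2) qp by (intro syn_append_eq) (auto simp: syn_eq_iff)
  ultimately show ?thesis by (simp add: syn_eq_iff[symmetric])
qed

text \<open>For \<open>L\<close> in \<open>G\<close>, inserting words of the class of
  \<open>[]\<close> changes nothing, so the threshold is \<open>0\<close>. The language of one
  letter has no word of length two or more, which settles nonempty words from threshold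
  \<open>2\<close> on. Union and concatenation intersect the identities of their arguments.\<close>

lemma SF_aperiodic:
  assumes "H \<in> SF G"
  shows "\<exists>L\<in>G. \<exists>k. [] \<in> L \<and> aperiodic_on L k H"
  using assms
proof (induction rule: SF.induct)
  case (SF_base L)
  have "x @ wpow w n @ y \<in> L \<longleftrightarrow> x @ wpow w (Suc n) @ y \<in> L" if "w \<in> syn {L} []" for w n x y
  proof -
    have "w @ wpow w n \<in> syn {L} ([] @ wpow w n)"
      using that by (intro syn_append) simp_all
    then show ?thesis by (simp add: syn_def)
  qed
  then have "aperiodic_on (syn {L} []) 0 L" by (rule aperiodic_onI)
  then show ?case using G_syn(1)[OF SF_base] syn_refl[of "[]" "{L}"] by fast
next
  case (SF_letter a)
  have "x @ wpow w n @ y \<in> {[a]} \<longleftrightarrow> x @ wpow w (Suc n) @ y \<in> {[a]}" if "n \<ge> 2" for w n x y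
  proof (cases "w = []")
    case False
    have "length (x @ wpow w m @ y) \<noteq> 1" if "m \<ge> 2" for m
    proof -
      have "length (wpow w m) = m * length w" by (simp add: length_concat sum_list_replicate)
      then have "length (wpow w m) \<ge> 2" using that False
        by (metis One_nat_def Suc_leI length_greater_0_conv mult.right_neutral mult_le_mono)
      then show ?thesis by simp
    qed
    from this[of n] this[of "Suc n"] that show ?thesis
      by (metis One_nat_def le_Suc_eq length_Cons list.size(3) singletonD)
  qed simp
  then have "aperiodic_on UNIV 2 {[a]}" by (intro aperiodic_onI)
  then show ?case using ba_UNIV[OF G_ba] by blast
next
  case (SF_union K1 K2)
  then obtain L1 k1 L2 k2 where
    L: "L1 \<in> G" "[] \<in> L1" "aperiodic_on L1 k1 K1" "L2 \<in> G" "[] \<in> L2" "aperiodic_on L2 k2 K2"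
    by blast
  have "aperiodic_on (L1 \<inter> L2) (max k1 k2) K1" "aperiodic_on (L1 \<inter> L2) (max k1 k2) K2"
    using aperiodic_on_mono[OF L(3)] aperiodic_on_mono[OF L(6)] by simp_all
  then have "aperiodic_on (L1 \<inter> L2) (max k1 k2) (K1 \<union> K2)"
    unfolding aperiodic_on_def Un_iff by blast
  then show ?case using L ba_Int[OF G_ba] by blast
next
  case (SF_compl K)
  have "aperiodic_on L k K \<Longrightarrow> aperiodic_on L k (UNIV - K)" for L k
    unfolding aperiodic_on_def Diff_iff by blast
  then show ?case using SF_compl by blast
next
  case (SF_conc K1 K2)
  then obtain L1 k1 L2 k2 where
    1: "L1 \<in> G" "[] \<in> L1" "aperiodic_on L1 k1 K1" and 2: "L2 \<in> G" "[] \<in> L2" "aperiodic_on L2 k2 K2"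
    by blast
  then have "aperiodic_on (L1 \<inter> L2) (Suc (k1 + k2)) (lconc K1 K2)"
    by (intro aperiodic_on_lconc) (auto intro: aperiodic_on_mono)
  then show ?case using ba_Int[OF G_ba 1(1) 2(1)] 1(2) 2(2) by blast
qed

end

section \<open>Prefix codes\<close>

definition prefix_code :: "'a list set \<Rightarrow> bool" where
  "prefix_code P \<longleftrightarrow> [] \<notin> P \<and> (\<forall>u v. u \<in> P \<longrightarrow> u @ v \<in> P \<longrightarrow> v = [])"

lemma prefix_code_subset: "prefix_code P \<Longrightarrow> Q \<subseteq> P \<Longrightarrow> prefix_code Q"
  unfolding prefix_code_def by blast

lemma prefix_code_cancel:
  assumes "prefix_code P" "u \<in> P" "u' \<in> P" "u @ v = u' @ v'"
  shows "u = u' \<and> v = v'"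
proof -
  obtain t where "u = u' @ t \<or> u @ t = u'" using assms(4) by (auto simp: append_eq_append_conv2)
  then have "u = u'" using assms(1-3) unfolding prefix_code_def by (metis append_Nil2)
  then show ?thesis using assms(4) by simp
qed

text \<open>Factorization over a prefix code is unique, so a word of \<open>lstar P\<close> is
  outside \<open>lstar Q\<close> exactly when one of its blocks lies in \<open>P - Q\<close>. On the
  right the star is applied only to \<open>P\<close>, so membership in \<open>SF G\<close> passes
  from \<open>lstar P\<close> to \<open>lstar Q\<close>, given \<open>P - Q\<close> in
  \<open>SF G\<close>.\<close>

lemma lstar_subset_code:
  assumes P: "prefix_code P" and Q: "Q \<subseteq> P"
  shows "lstar Q = lstar P - lconc (lstar P) (lconc (P - Q) (lstar P))"
proof
  have "w \<in> lstar Q \<Longrightarrow> u \<in> lstar P \<Longrightarrow> c \<in> P - Q \<Longrightarrow> w \<noteq> u @ c @ v" for w u c v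
  proof (induction arbitrary: u rule: lstar.induct)
    case lstar_nil
    then show ?case using P by (auto simp: prefix_code_def)
  next
    case (lstar_app q w)
    show ?case
    proof
      assume eq: "q @ w = u @ c @ v"
      have q: "q \<in> P" using lstar_app Q by blast
      from lstar_app.prems(1) show False
      proof cases
        case lstar_nil
        then show False using prefix_code_cancel[OF P q, of c w v] eq lstar_app by auto
      next
        case (lstar_app p u')
        then have "w = u' @ c @ v" using prefix_code_cancel[OF P q, of p w "u' @ c @ v"] eq by simp
        then show False using lstar_app.IH lstar_app(3) \<open>c \<in> P - Q\<close> by blast
      qed
    qed
  qed
  then show "lstar Q \<subseteq> lstar P - lconc (lstar P) (lconc (P - Q) (lstar P))"
    using lstar_mono[OF Q] by (auto elim!: lconcE)
next
  have "w \<in> lstar P \<Longrightarrow> w \<notin> lconc (lstar P) (lconc (P - Q) (lstar P)) \<Longrightarrow> w \<in> lstar Q" for w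
  proof (induction rule: lstar.induct)
    case lstar_nil
    show ?case by (rule lstar.lstar_nil)
  next
    case (lstar_app p w)
    have "p \<in> Q"
    proof (rule ccontr)
      assume "p \<notin> Q"
      then have "[] @ p @ w \<in> lconc (lstar P) (lconc (P - Q) (lstar P))"
        using lstar_app.hyps lstar_app.prems by (intro lconcI lstar.lstar_nil) auto
      then show False using lstar_app.prems by simp
    qed
    moreover have "w \<notin> lconc (lstar P) (lconc (P - Q) (lstar P))"
    proof
      assume "w \<in> lconc (lstar P) (lconc (P - Q) (lstar P))"
      then obtain u v where "w = u @ v" "u \<in> lstar P" "v \<in> lconc (P - Q) (lstar P)" by (rule lconcE)
      then have "(p @ u) @ v \<in> lconc (lstar P) (lconc (P - Q) (lstar P))"
        using lstar_app.hyps by (intro lconcI lstar.lstar_app)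
      then show False using lstar_app.prems \<open>w = u @ v\<close> by simp
    qed
    ultimately show ?case using lstar_app.IH by (blast intro: lstar.lstar_app)
  qed
  then show "lstar P - lconc (lstar P) (lconc (P - Q) (lstar P)) \<subseteq> lstar Q" by blast
qed

text \<open>A word of the new code has exactly one block in \<open>C\<close>, its last one. If one
  such word is a prefix of another, the two agree block by block up to that block, where both
  end.\<close>

lemma prefix_code_marked:
  assumes P: "prefix_code P" and C: "C \<subseteq> P"
  shows "prefix_code (lconc (lstar (P - C)) C)"
proof -
  have *: "w \<in> lstar (P - C) \<Longrightarrow> w' \<in> lstar (P - C) \<Longrightarrow> c \<in> C \<Longrightarrow> c' \<in> C \<Longrightarrow> w @ c @ v = w' @ c' \<Longrightarrow> v = []"
    for w w' c c' v
  proof (induction arbitrary: w' rule: lstar.induct)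
    case lstar_nil
    from lstar_nil(1) show ?case
    proof cases
      case lstar_nil
      then show ?thesis
        using prefix_code_cancel[OF P, of c c' v "[]"] \<open>[] @ c @ v = w' @ c'\<close> \<open>c \<in> C\<close> \<open>c' \<in> C\<close> C by auto
    next
      case (lstar_app b u)
      then show ?thesis
        using prefix_code_cancel[OF P, of c b v "u @ c'"] lstar_nil(2,4) C by auto
    qed
  next
    case (lstar_app b w)
    from lstar_app.prems(1) show ?case
    proof cases
      case lstar_nil
      then show ?thesis
        using prefix_code_cancel[OF P, of b c' "w @ c @ v" "[]"] lstar_app.hyps lstar_app.prems C by auto
    next
      case (lstar_app b' u)
      then have "w @ c @ v = u @ c'"
        using prefix_code_cancel[OF P, of b b' "w @ c @ v" "u @ c'"] \<open>b \<in> P - C\<close> \<open>(b @ w) @ c @ v = w' @ c'\<close>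
        by simp
      then show ?thesis using lstar_app.IH[OF lstar_app(3)] \<open>c \<in> C\<close> \<open>c' \<in> C\<close> by blast
    qed
  qed
  have "[] \<notin> lconc (lstar (P - C)) C"
    using P C by (auto simp: prefix_code_def elim!: lconcE)
  moreover have "v = []" if "u \<in> lconc (lstar (P - C)) C" "u @ v \<in> lconc (lstar (P - C)) C" for u v
    using that * by (auto elim!: lconcE)
  ultimately show ?thesis unfolding prefix_code_def by blast
qed

text \<open>Cutting after each block in \<open>C\<close> gives \<open>n\<close>; \<open>b\<close>
  holds the blocks behind the last cut. A new first block outside \<open>C\<close> joins the first
  marked block, or \<open>b\<close> if there is none.\<close>

lemma lstar_marked_decomp:
  assumes "w \<in> lstar P"
  shows "\<exists>n b. w = n @ b \<and> n \<in> lstar (lconc (lstar (P - C)) C) \<and> b \<in> lstar (P - C)"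
  using assms
proof (induction rule: lstar.induct)
  case lstar_nil
  show ?case using lstar.lstar_nil by blast
next
  case (lstar_app p w)
  let ?N = "lconc (lstar (P - C)) C"
  from lstar_app.IH obtain n b where nb: "w = n @ b" "n \<in> lstar ?N" "b \<in> lstar (P - C)" by blast
  show ?case
  proof (cases "p \<in> C")
    case True
    then have "[] @ p \<in> ?N" by (intro lconcI lstar.lstar_nil)
    then have "p @ n \<in> lstar ?N" using nb by (auto intro: lstar.lstar_app)
    then show ?thesis using nb by (intro exI[of _ "p @ n"] exI[of _ b]) simp
  next
    case False
    then have p: "p \<in> P - C" using lstar_app by blast
    from nb(2) show ?thesis
    proof cases
      case lstar_nil
      then show ?thesis using nb p
        by (intro exI[of _ "[]"] exI[of _ "p @ b"]) (auto intro: lstar.intros)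
    next
      case (lstar_app m n')
      then obtain b1 c where m: "m = b1 @ c" "b1 \<in> lstar (P - C)" "c \<in> C" by (auto elim: lconcE)
      then have "(p @ b1) @ c \<in> ?N" using p by (intro lconcI lstar.lstar_app)
      then have "p @ n \<in> lstar ?N" using lstar_app m lstar.lstar_app[of "(p @ b1) @ c" ?N n'] by simp
      then show ?thesis using nb by (intro exI[of _ "p @ n"] exI[of _ b]) simp
    qed
  qed
qed

text \<open>The nonempty words concerned are those of \<open>lstar P\<close> whose last block is in
  \<open>C\<close>. No star other than \<open>lstar P\<close> is left, which puts the star of the
  marked code into \<open>SF G\<close>.\<close>

lemma lstar_marked:
  assumes "C \<subseteq> P"
  shows "lstar (lconc (lstar (P - C)) C) = insert [] (lconc (lstar P) C)" (is "lstar ?N = ?R")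
proof
  have "w \<in> lstar ?N \<Longrightarrow> w \<in> ?R" for w
  proof (induction rule: lstar.induct)
    case (lstar_app u v)
    then obtain b c where u: "u = b @ c" "b \<in> lstar P" "c \<in> C"
      using lstar_mono[of "P - C" P] by (auto elim!: lconcE)
    from lstar_app.IH show ?case
    proof
      assume "v = []"
      then show ?thesis using u by (auto intro: lconcI)
    next
      assume "v \<in> lconc (lstar P) C"
      then obtain v1 c1 where "v = v1 @ c1" "v1 \<in> lstar P" "c1 \<in> C" by (auto elim: lconcE)
      moreover have "(b @ c) @ v1 \<in> lstar P"
        using u calculation assms by (intro lstar_append[of _ P]) (auto intro: lstar_single)
      ultimately have "((b @ c) @ v1) @ c1 \<in> lconc (lstar P) C" by (intro lconcI)
      then show ?thesis using u \<open>v = v1 @ c1\<close> by simp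
    qed
  qed simp
  then show "lstar ?N \<subseteq> ?R" by blast
next
  have "u @ c \<in> lstar ?N" if "u \<in> lstar P" "c \<in> C" for u c
  proof -
    obtain n b where "u = n @ b" "n \<in> lstar ?N" "b \<in> lstar (P - C)"
      using lstar_marked_decomp[OF \<open>u \<in> lstar P\<close>] by blast
    moreover from this that have "b @ c \<in> lstar ?N" by (intro lstar_single[of _ ?N] lconcI)
    ultimately show ?thesis using lstar_append[of n ?N "b @ c"] by simp
  qed
  then show "?R \<subseteq> lstar ?N" by (auto elim!: lconcE intro: lstar.lstar_nil)
qed

section \<open>Rating maps into finite idempotent semirings\<close>

locale rating =
  fixes pl :: "'r::finite \<Rightarrow> 'r \<Rightarrow> 'r" (infixl "\<boxplus>" 65)
    and tm :: "'r \<Rightarrow> 'r \<Rightarrow> 'r" (infixl "\<boxdot>" 70)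
    and z e :: 'r and \<omega> :: nat and \<rho> :: "'a list set \<Rightarrow> 'r"
  assumes semiring: "idem_semiring pl z tm e"
    and rating_map: "rating_map pl z \<rho>" and nice: "nice \<rho>" and mult: "multiplicative tm e \<rho>"
    and omega_pos: "\<omega> > 0"
    and omega: "\<forall>r. tm (rpow tm e r \<omega>) (rpow tm e r \<omega>) = rpow tm e r \<omega>"
begin

abbreviation le (infix "\<preceq>" 50) where "x \<preceq> y \<equiv> rle pl x y"
abbreviation pow :: "'r \<Rightarrow> nat \<Rightarrow> 'r" where "pow r n \<equiv> rpow tm e r n"

lemma pl_assoc: "(x \<boxplus> y) \<boxplus> w = x \<boxplus> (y \<boxplus> w)" and pl_comm: "x \<boxplus> y = y \<boxplus> x"
  and pl_z [simp]: "z \<boxplus> x = x" and pl_idem [simp]: "x \<boxplus> x = x"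
  and tm_assoc: "(x \<boxdot> y) \<boxdot> w = x \<boxdot> (y \<boxdot> w)"
  and e_tm [simp]: "e \<boxdot> x = x" and tm_e [simp]: "x \<boxdot> e = x"
  and tm_pl: "x \<boxdot> (y \<boxplus> w) = (x \<boxdot> y) \<boxplus> (x \<boxdot> w)"
  and pl_tm: "(y \<boxplus> w) \<boxdot> x = (y \<boxdot> x) \<boxplus> (w \<boxdot> x)"
  and z_tm [simp]: "z \<boxdot> x = z" and tm_z [simp]: "x \<boxdot> z = z"
  using semiring unfolding idem_semiring_def by blast+

lemma le_refl [simp]: "x \<preceq> x" by (simp add: rle_def)
lemma le_trans [trans]: "x \<preceq> y \<Longrightarrow> y \<preceq> w \<Longrightarrow> x \<preceq> w" by (metis rle_def pl_assoc)
lemma z_le [simp]: "z \<preceq> x" by (simp add: rle_def)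
lemma le_pl1: "x \<preceq> x \<boxplus> y" by (metis rle_def pl_assoc pl_idem)
lemma le_pl2: "y \<preceq> x \<boxplus> y" by (metis le_pl1 pl_comm)
lemma pl_least: "x \<preceq> w \<Longrightarrow> y \<preceq> w \<Longrightarrow> x \<boxplus> y \<preceq> w" by (metis rle_def pl_assoc)

lemma tm_mono:
  assumes "x \<preceq> x'" "y \<preceq> y'" shows "x \<boxdot> y \<preceq> x' \<boxdot> y'"
proof (rule le_trans)
  show "x \<boxdot> y \<preceq> x' \<boxdot> y" using assms(1) pl_tm by (metis rle_def)
  show "x' \<boxdot> y \<preceq> x' \<boxdot> y'" using assms(2) tm_pl by (metis rle_def)
qed

lemma rho_empty [simp]: "\<rho> {} = z" and rho_Un: "\<rho> (K1 \<union> K2) = \<rho> K1 \<boxplus> \<rho> K2"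
  and rho_eps [simp]: "\<rho> {[]} = e" and rho_lconc: "\<rho> (lconc K1 K2) = \<rho> K1 \<boxdot> \<rho> K2"
  using rating_map mult by (auto simp: rating_map_def multiplicative_def)

lemma rho_append: "\<rho> {u @ v} = \<rho> {u} \<boxdot> \<rho> {v}"
proof -
  have "lconc {u} {v} = {u @ v}" by (auto simp: lconc_def)
  then show ?thesis by (metis rho_lconc)
qed

lemma rho_mono: "K \<subseteq> K' \<Longrightarrow> \<rho> K \<preceq> \<rho> K'"
  by (metis rho_Un rle_def sup.absorb2)

text \<open>Niceness replaces \<open>K\<close> by a finite subset, whose rating is a finite sum of
  ratings of words.\<close>

lemma rho_least:
  assumes "\<And>w. w \<in> K \<Longrightarrow> x \<boxdot> \<rho> {w} \<preceq> u"
  shows "x \<boxdot> \<rho> K \<preceq> u"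
proof -
  obtain F where F: "F \<subseteq> K" "finite F" "\<rho> K = \<rho> F" using nice unfolding nice_def by metis
  from F(2,1) have "x \<boxdot> \<rho> F \<preceq> u"
  proof (induction rule: finite_induct)
    case (insert w F)
    then show ?case using assms rho_Un[of "{w}" F] by (auto simp: tm_pl intro: pl_least)
  qed simp
  then show ?thesis using F(3) by simp
qed

section \<open>Powers and stable sets in the semiring\<close>

lemma pow_0 [simp]: "pow r 0 = e" and pow_Suc: "pow r (Suc n) = r \<boxdot> pow r n"
  by (simp_all add: rpow_def)

lemma pow_add: "pow r (m + n) = pow r m \<boxdot> pow r n"
  by (induction m) (simp_all add: pow_Suc tm_assoc)

lemma pow_1 [simp]: "pow r (Suc 0) = r"
  by (simp add: pow_Suc)

lemma pow_Suc_right: "pow r (Suc n) = pow r n \<boxdot> r"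
  using pow_add[of r n 1] by simp

lemma pow_omega_idem [simp]: "pow r \<omega> \<boxdot> pow r \<omega> = pow r \<omega>"
  using omega by blast

lemma pow_omega_mult: "k > 0 \<Longrightarrow> pow r (k * \<omega>) = pow r \<omega>"
proof (induction k)
  case (Suc k)
  then show ?case by (cases "k = 0") (simp_all add: pow_add)
qed simp

text \<open>The algebraic closure conditions of \<open>SF_complete\<close> together with the unit.
  Downward closure is kept apart, since it need not survive the passage to right multiples in
  \<open>stable_local\<close>.\<close>

definition stable :: "'r set \<Rightarrow> bool" where
  "stable T \<longleftrightarrow> e \<in> T \<and> (\<forall>s\<in>T. \<forall>t\<in>T. s \<boxdot> t \<in> T) \<and> (\<forall>r\<in>T. pow r \<omega> \<boxplus> pow r (\<omega> + 1) \<in> T)"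

lemma stable_pow: "stable T \<Longrightarrow> r \<in> T \<Longrightarrow> pow r n \<in> T"
  by (induction n) (auto simp: stable_def pow_Suc)

lemma pow_conjugate: "pow (t \<boxdot> c) (Suc n) = t \<boxdot> pow (c \<boxdot> t) n \<boxdot> c"
  by (induction n) (simp_all add: pow_Suc tm_assoc)

text \<open>Powers of \<open>t \<boxdot> c\<close> are conjugate to powers of
  \<open>c \<boxdot> t\<close>, an element of \<open>T\<close>. So the sum of powers is formed
  inside \<open>T\<close>, and one factor \<open>c\<close> is split off on the right.\<close>

lemma stable_local:
  assumes T: "stable T" and c: "c \<in> T"
  shows "stable (insert e ((\<lambda>t. t \<boxdot> c) ` T))"
proof -
  have *: "pow (t \<boxdot> c) \<omega> \<boxplus> pow (t \<boxdot> c) (\<omega> + 1) \<in> (\<lambda>t. t \<boxdot> c) ` T" if t: "t \<in> T" for t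
  proof
    let ?q = "pow (c \<boxdot> t) \<omega> \<boxplus> pow (c \<boxdot> t) (\<omega> + 1)"
    let ?s = "t \<boxdot> pow (c \<boxdot> t) (\<omega> - 1) \<boxdot> ?q"
    have "c \<boxdot> t \<in> T" using T c t by (auto simp: stable_def)
    then have "?q \<in> T" "pow (c \<boxdot> t) (\<omega> - 1) \<in> T" using T stable_pow by (auto simp: stable_def)
    then show "?s \<in> T" using T t unfolding stable_def by blast
    \<comment> \<open>\<open>\<omega>\<close> is doubled because conjugation uses up one factor:
      what remains still contains the full powers \<open>\<omega>\<close> and
      \<open>\<omega> + 1\<close> of \<open>c \<boxdot> t\<close>.\<close>
    have n: "\<omega> + \<omega> = Suc ((\<omega> - 1) + \<omega>)" "\<omega> + \<omega> + 1 = Suc ((\<omega> - 1) + (\<omega> + 1))"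
      using omega_pos by simp_all
    have "pow (t \<boxdot> c) \<omega> = pow (t \<boxdot> c) (\<omega> + \<omega>)" by (simp add: pow_add)
    then have 1: "pow (t \<boxdot> c) \<omega> = t \<boxdot> (pow (c \<boxdot> t) (\<omega> - 1) \<boxdot> pow (c \<boxdot> t) \<omega>) \<boxdot> c"
      unfolding n(1) pow_conjugate pow_add .
    have "pow (t \<boxdot> c) (\<omega> + 1) = pow (t \<boxdot> c) (\<omega> + \<omega> + 1)" by (simp only: pow_add pow_omega_idem)
    then have 2: "pow (t \<boxdot> c) (\<omega> + 1) = t \<boxdot> (pow (c \<boxdot> t) (\<omega> - 1) \<boxdot> pow (c \<boxdot> t) (\<omega> + 1)) \<boxdot> c"
      unfolding n(2) pow_conjugate pow_add[of _ "\<omega> - 1"] .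
    show "pow (t \<boxdot> c) \<omega> \<boxplus> pow (t \<boxdot> c) (\<omega> + 1) = ?s \<boxdot> c"
      unfolding 1 2 by (simp only: tm_pl pl_tm tm_assoc)
  qed
  have pow_e: "pow e n = e" for n by (induction n) (simp_all add: pow_Suc)
  have "(t \<boxdot> c) \<boxdot> (t' \<boxdot> c) \<in> (\<lambda>t. t \<boxdot> c) ` T" if "t \<in> T" "t' \<in> T" for t t'
  proof
    show "(t \<boxdot> c) \<boxdot> (t' \<boxdot> c) = (t \<boxdot> c \<boxdot> t') \<boxdot> c" by (simp add: tm_assoc)
    show "t \<boxdot> c \<boxdot> t' \<in> T" using T c that unfolding stable_def by blast
  qed
  with * pow_e show ?thesis unfolding stable_def by auto
qed

text \<open>If \<open>t\<close> permutes \<open>X\<close>, its idempotent power fixes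
  \<open>X\<close> pointwise, so \<open>pow t \<omega> \<boxplus> pow t (\<omega> + 1)\<close> sends
  \<open>x\<close> to \<open>x \<boxplus> x \<boxdot> t\<close>. The product of these elements over
  the finite set \<open>U\<close> is the bound. The clause \<open>x \<preceq> x \<boxdot> s\<close>
  carries the induction.\<close>

lemma permuting_bound:
  assumes T: "stable T"
    and U: "U \<subseteq> T" "\<And>t. t \<in> U \<Longrightarrow> (\<lambda>x. x \<boxdot> t) ` X = X"
  shows "\<exists>s\<in>T. \<forall>x\<in>X. x \<preceq> x \<boxdot> s \<and> (\<forall>t\<in>U. x \<boxdot> t \<preceq> x \<boxdot> s)"
proof -
  have "finite U" by simp
  then show ?thesis using U
  proof (induction rule: finite_induct)
    case empty
    have "e \<in> T" using T by (simp add: stable_def)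
    then show ?case by (intro bexI[of _ e]) auto
  next
    case (insert t U)
    then obtain s where s: "s \<in> T" "\<And>x. x \<in> X \<Longrightarrow> x \<preceq> x \<boxdot> s" "\<And>x t. x \<in> X \<Longrightarrow> t \<in> U \<Longrightarrow> x \<boxdot> t \<preceq> x \<boxdot> s"
      by (metis insert_subset insertI2)
    have tX: "(\<lambda>x. x \<boxdot> t) ` X = X" and t: "t \<in> T" using insert.prems by auto
    have powX: "(\<lambda>x. x \<boxdot> pow t n) ` X = X" for n
    proof (induction n)
      case (Suc n)
      have "(\<lambda>x. x \<boxdot> pow t (Suc n)) ` X = (\<lambda>x. x \<boxdot> pow t n) ` (\<lambda>x. x \<boxdot> t) ` X"
        by (simp add: image_image pow_Suc tm_assoc)
      then show ?case using Suc tX by simp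
    qed simp
    have fix': "x \<boxdot> pow t \<omega> = x" if "x \<in> X" for x
    proof -
      obtain y where "x = y \<boxdot> pow t \<omega>" using powX[of \<omega>] \<open>x \<in> X\<close> by blast
      then show ?thesis by (simp add: tm_assoc)
    qed
    let ?s = "(pow t \<omega> \<boxplus> pow t (\<omega> + 1)) \<boxdot> s"
    have val: "x \<boxdot> ?s = x \<boxdot> s \<boxplus> x \<boxdot> t \<boxdot> s" if "x \<in> X" for x
    proof -
      have "x \<boxdot> ?s = x \<boxdot> pow t \<omega> \<boxdot> s \<boxplus> x \<boxdot> pow t \<omega> \<boxdot> t \<boxdot> s"
        by (simp add: pow_Suc_right tm_pl pl_tm tm_assoc)
      then show ?thesis using fix'[OF that] by simp
    qed
    have "x \<preceq> x \<boxdot> ?s \<and> (\<forall>t'\<in>insert t U. x \<boxdot> t' \<preceq> x \<boxdot> ?s)" if x: "x \<in> X" for x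
    proof -
      have a: "x \<boxdot> s \<preceq> x \<boxdot> ?s" "x \<boxdot> t \<boxdot> s \<preceq> x \<boxdot> ?s" unfolding val[OF x] by (rule le_pl1, rule le_pl2)
      have "x \<boxdot> t \<in> X" using tX x by blast
      then have "x \<boxdot> t \<preceq> x \<boxdot> ?s" using s(2) a(2) le_trans by blast
      then show ?thesis using s(2,3)[OF x] a(1) le_trans by blast
    qed
    moreover have "?s \<in> T" using T t s(1) unfolding stable_def by blast
    ultimately show ?case by blast
  qed
qed

end

section \<open>Covers\<close>

locale rated_group_based = group_based G + rating pl tm z e \<omega> \<rho>
  for G :: "('a::finite) list set set"
    and pl :: "'r::finite \<Rightarrow> 'r \<Rightarrow> 'r" (infixl "\<boxplus>" 65)
    and tm :: "'r \<Rightarrow> 'r \<Rightarrow> 'r" (infixl "\<boxdot>" 70)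
    and z e :: 'r and \<omega> :: nat and \<rho> :: "'a list set \<Rightarrow> 'r"
begin

definition covered :: "('a list set \<Rightarrow> bool) \<Rightarrow> 'a list set \<Rightarrow> bool" where
  "covered \<Phi> M \<longleftrightarrow> (\<exists>KK. is_cover (SF G) M KK \<and> (\<forall>K\<in>KK. \<Phi> K))"

lemma covered_single: "K \<in> SF G \<Longrightarrow> \<Phi> K \<Longrightarrow> covered \<Phi> K"
  unfolding covered_def is_cover_def by (intro exI[of _ "{K}"]) auto

lemma covered_empty: "covered \<Phi> {}"
  unfolding covered_def is_cover_def by (intro exI[of _ "{}"]) auto

lemma covered_mono: "covered \<Phi> M \<Longrightarrow> N \<subseteq> M \<Longrightarrow> (\<And>K. \<Phi> K \<Longrightarrow> \<Psi> K) \<Longrightarrow> covered \<Psi> N"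
  unfolding covered_def is_cover_def by (meson order_trans)

lemma covered_Un:
  assumes "covered \<Phi> M" "covered \<Phi> N" shows "covered \<Phi> (M \<union> N)"
proof -
  obtain KK LL where "is_cover (SF G) M KK \<and> (\<forall>K\<in>KK. \<Phi> K)" "is_cover (SF G) N LL \<and> (\<forall>K\<in>LL. \<Phi> K)"
    using assms unfolding covered_def by blast
  then show ?thesis unfolding covered_def is_cover_def by (intro exI[of _ "KK \<union> LL"]) auto
qed

lemma covered_UN: "finite I \<Longrightarrow> (\<And>i. i \<in> I \<Longrightarrow> covered \<Phi> (M i)) \<Longrightarrow> covered \<Phi> (\<Union>i\<in>I. M i)"
  by (induction rule: finite_induct) (auto intro: covered_Un covered_empty)

lemma covered_lconc:
  assumes "covered \<Phi> M" "covered \<Psi> N" "\<And>A B. \<Phi> A \<Longrightarrow> \<Psi> B \<Longrightarrow> \<Theta> (lconc A B)"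
  shows "covered \<Theta> (lconc M N)"
proof -
  obtain KK LL where KK: "is_cover (SF G) M KK" "\<And>K. K \<in> KK \<Longrightarrow> \<Phi> K"
    and LL: "is_cover (SF G) N LL" "\<And>K. K \<in> LL \<Longrightarrow> \<Psi> K"
    using assms(1,2) unfolding covered_def by blast
  let ?C = "(\<lambda>(A, B). lconc A B) ` (KK \<times> LL)"
  have "finite ?C" "?C \<subseteq> SF G" "\<forall>K\<in>?C. \<Theta> K"
    using KK LL assms(3) by (auto simp: is_cover_def intro: SF.SF_conc)
  moreover have "lconc M N \<subseteq> \<Union>?C"
  proof
    fix w assume "w \<in> lconc M N"
    then obtain u v where uv: "w = u @ v" "u \<in> M" "v \<in> N" by (rule lconcE)
    then obtain A B where "A \<in> KK" "u \<in> A" "B \<in> LL" "v \<in> B"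
      using KK(1) LL(1) unfolding is_cover_def by blast
    then show "w \<in> \<Union>?C" using uv by (auto intro!: bexI[of _ "(A, B)"] lconcI)
  qed
  ultimately show ?thesis unfolding covered_def is_cover_def by blast
qed

text \<open>The bound is tested only behind left factors from \<open>X\<close>. Shrinking
  \<open>X\<close> weakens the condition, which the induction for the star exploits.\<close>

definition dominated :: "'r set \<Rightarrow> 'r set \<Rightarrow> 'a list set \<Rightarrow> bool" where
  "dominated X T K \<longleftrightarrow> (\<exists>t\<in>T. \<forall>x\<in>X. x \<boxdot> \<rho> K \<preceq> x \<boxdot> t)"

text \<open>A cover read as a finite partition: the colour of a word is an element of
  \<open>T\<close> that dominates its whole colour class.\<close>

definition coloured :: "'r set \<Rightarrow> 'r set \<Rightarrow> 'a list set \<Rightarrow> ('a list \<Rightarrow> 'r) \<Rightarrow> bool" where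
  "coloured X T M \<kappa> \<longleftrightarrow> \<kappa> ` M \<subseteq> T \<and> (\<forall>t. {w\<in>M. \<kappa> w = t} \<in> SF G) \<and>
     (\<forall>t. \<forall>x\<in>X. x \<boxdot> \<rho> {w\<in>M. \<kappa> w = t} \<preceq> x \<boxdot> t)"

text \<open>Each word takes the bound of one cover member that contains it. Classes with equal
  bounds may merge, as a sum stays below a common bound.\<close>

lemma covered_coloured:
  assumes "covered (dominated X T) M" "M \<in> SF G"
  shows "\<exists>\<kappa>. coloured X T M \<kappa>"
proof -
  obtain KK where "finite KK" "KK \<subseteq> SF G" "M \<subseteq> \<Union>KK" "\<forall>K\<in>KK. dominated X T K"
    using assms(1) unfolding covered_def is_cover_def by blast
  then show ?thesis using assms(2)
  proof (induction arbitrary: M rule: finite_induct)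
    case empty
    then show ?case by (auto simp: coloured_def intro: ba_empty[OF SF_ba])
  next
    case (insert K KK)
    have MK: "M - K \<in> SF G" "M \<inter> K \<in> SF G"
      using insert.prems by (auto intro: ba_Diff[OF SF_ba] ba_Int[OF SF_ba])
    then obtain \<kappa> where \<kappa>: "coloured X T (M - K) \<kappa>" using insert.IH[of "M - K"] insert.prems by auto
    obtain t0 where t0: "t0 \<in> T" "\<And>x. x \<in> X \<Longrightarrow> x \<boxdot> \<rho> K \<preceq> x \<boxdot> t0"
      using insert.prems unfolding dominated_def by auto
    define \<kappa>' where "\<kappa>' w = (if w \<in> K then t0 else \<kappa> w)" for w
    have eq: "{w\<in>M. \<kappa>' w = t} = (if t = t0 then M \<inter> K else {}) \<union> {w\<in>M - K. \<kappa> w = t}" for t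
      by (auto simp: \<kappa>'_def)
    have "x \<boxdot> \<rho> {w\<in>M. \<kappa>' w = t} \<preceq> x \<boxdot> t" if x: "x \<in> X" for t x
    proof -
      have "x \<boxdot> \<rho> (M \<inter> K) \<preceq> x \<boxdot> t0"
        using t0(2)[OF x] tm_mono[OF le_refl rho_mono] le_trans by (meson inf_le2)
      then show ?thesis unfolding eq rho_Un tm_pl using \<kappa> x
        by (intro pl_least) (auto simp: coloured_def)
    qed
    moreover have "{w\<in>M. \<kappa>' w = t} \<in> SF G" for t
      unfolding eq using \<kappa> MK by (intro SF.SF_union) (auto simp: coloured_def intro: ba_empty[OF SF_ba])
    moreover have "\<kappa>' ` M \<subseteq> T" using \<kappa> t0 by (auto simp: \<kappa>'_def coloured_def)
    ultimately show ?case unfolding coloured_def by blast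
  qed
qed

text \<open>Once \<open>\<rho> K\<close> is replaced by \<open>t\<close>, the language
  \<open>L\<close> stands behind factors \<open>x \<boxdot> t\<close>, so it has to be dominated
  only on a set \<open>Y\<close> containing these.\<close>

lemma dominated_lconc:
  assumes "dominated X T K" "dominated Y U L"
    "\<And>t. t \<in> T \<Longrightarrow> (\<lambda>x. x \<boxdot> t) ` X \<subseteq> Y" "\<And>t u. t \<in> T \<Longrightarrow> u \<in> U \<Longrightarrow> t \<boxdot> u \<in> V"
  shows "dominated X V (lconc K L)"
proof -
  obtain t where t: "t \<in> T" "\<And>x. x \<in> X \<Longrightarrow> x \<boxdot> \<rho> K \<preceq> x \<boxdot> t" using assms(1) unfolding dominated_def by blast
  obtain u where u: "u \<in> U" "\<And>x. x \<in> Y \<Longrightarrow> x \<boxdot> \<rho> L \<preceq> x \<boxdot> u" using assms(2) unfolding dominated_def by blast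
  have "x \<boxdot> \<rho> (lconc K L) \<preceq> x \<boxdot> (t \<boxdot> u)" if x: "x \<in> X" for x
  proof -
    have "x \<boxdot> \<rho> K \<boxdot> \<rho> L \<preceq> x \<boxdot> t \<boxdot> \<rho> L" using t(2)[OF x] by (rule tm_mono) simp
    also have "x \<boxdot> t \<boxdot> \<rho> L \<preceq> x \<boxdot> t \<boxdot> u" using u(2) assms(3)[OF t(1)] x by blast
    finally show ?thesis by (simp add: rho_lconc tm_assoc)
  qed
  then show ?thesis using assms(4)[OF t(1) u(1)] unfolding dominated_def by blast
qed

text \<open>The monoid \<open>T\<close> acts on \<open>X\<close> by right multiplication. If all colours act as permutations,
  stability of \<open>T\<close> bounds the whole star by one element. Otherwise a colour \<open>c\<close> shrinks \<open>X\<close>; cutting words after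
  the blocks of colour \<open>c\<close> yields a code acting on the smaller set \<open>X c\<close> through \<open>T c\<close>.\<close>

lemma lstar_covered:
  assumes "stable T" "\<And>x t. x \<in> X \<Longrightarrow> t \<in> T \<Longrightarrow> x \<boxdot> t \<in> X"
    and "prefix_code P" "coloured X T P \<kappa>" "lstar P \<in> SF G"
  shows "covered (dominated X T) (lstar P)"
  using assms
proof (induction "card X" arbitrary: X T P \<kappa> rule: less_induct)
  case outer: less
  \<comment> \<open>The induction is lexicographic: outside on the size of \<open>X\<close>, inside,
    for fixed \<open>X\<close> and \<open>T\<close>, on the number of colours.\<close>
  from outer.prems show ?case
  proof (induction "card (\<kappa> ` P)" arbitrary: P \<kappa> rule: less_induct)
    case inner: less
    note T = inner.prems(1) and act = inner.prems(2) and P = inner.prems(3)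
      and col = inner.prems(4) and star = inner.prems(5)
    have colT: "\<kappa> ` P \<subseteq> T" and colSF: "\<And>t. {w\<in>P. \<kappa> w = t} \<in> SF G"
      and colX: "\<And>t x. x \<in> X \<Longrightarrow> x \<boxdot> \<rho> {w\<in>P. \<kappa> w = t} \<preceq> x \<boxdot> t"
      using col unfolding coloured_def by blast+
    have TT: "\<And>s t. s \<in> T \<Longrightarrow> t \<in> T \<Longrightarrow> s \<boxdot> t \<in> T" and eT: "e \<in> T" using T unfolding stable_def by blast+
    show ?case
    proof (cases "\<forall>t\<in>\<kappa> ` P. (\<lambda>x. x \<boxdot> t) ` X = X")
      case True
      \<comment> \<open>\<open>U\<close> contains \<open>e\<close> and all colours and is closed
        under products, so every word of the star is dominated by an element of \<open>U\<close>.
        The bound \<open>s\<close> then serves all words at once.\<close>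
      define U where "U = {t\<in>T. (\<lambda>x. x \<boxdot> t) ` X = X}"
      have "\<exists>s\<in>T. \<forall>x\<in>X. x \<preceq> x \<boxdot> s \<and> (\<forall>t\<in>U. x \<boxdot> t \<preceq> x \<boxdot> s)"
        by (rule permuting_bound[OF T]) (auto simp only: U_def)
      then obtain s where s: "s \<in> T" "\<And>x t. x \<in> X \<Longrightarrow> t \<in> U \<Longrightarrow> x \<boxdot> t \<preceq> x \<boxdot> s" by blast
      have word: "\<exists>t\<in>U. \<forall>x\<in>X. x \<boxdot> \<rho> {w} \<preceq> x \<boxdot> t" if "w \<in> lstar P" for w
        using that
      proof (induction rule: lstar.induct)
        case lstar_nil
        show ?case using eT by (intro bexI[of _ e]) (auto simp: U_def)
      next
        case (lstar_app p w)
        then obtain t where t: "t \<in> U" "\<And>x. x \<in> X \<Longrightarrow> x \<boxdot> \<rho> {w} \<preceq> x \<boxdot> t" by blast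
        have \<kappa>p: "\<kappa> p \<in> U" using True colT lstar_app(1) by (auto simp: U_def)
        have "x \<boxdot> \<rho> {p @ w} \<preceq> x \<boxdot> (\<kappa> p \<boxdot> t)" if x: "x \<in> X" for x
        proof -
          have "{p} \<subseteq> {w\<in>P. \<kappa> w = \<kappa> p}" using lstar_app(1) by blast
          then have "x \<boxdot> \<rho> {p} \<preceq> x \<boxdot> \<rho> {w\<in>P. \<kappa> w = \<kappa> p}" by (intro tm_mono le_refl rho_mono)
          then have "x \<boxdot> \<rho> {p} \<preceq> x \<boxdot> \<kappa> p" using colX[OF x] le_trans by blast
          then have "x \<boxdot> \<rho> {p} \<boxdot> \<rho> {w} \<preceq> x \<boxdot> \<kappa> p \<boxdot> \<rho> {w}" by (rule tm_mono) simp
          also have "x \<boxdot> \<kappa> p \<boxdot> \<rho> {w} \<preceq> x \<boxdot> \<kappa> p \<boxdot> t"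
            using t(2) act x \<kappa>p by (auto simp: U_def)
          finally show ?thesis by (simp add: rho_append tm_assoc)
        qed
        moreover have "(\<lambda>x. x \<boxdot> (\<kappa> p \<boxdot> t)) ` X = (\<lambda>x. x \<boxdot> t) ` (\<lambda>x. x \<boxdot> \<kappa> p) ` X"
          by (simp add: image_image tm_assoc)
        then have "\<kappa> p \<boxdot> t \<in> U" using \<kappa>p t(1) TT by (simp add: U_def)
        ultimately show ?case by blast
      qed
      have "x \<boxdot> \<rho> (lstar P) \<preceq> x \<boxdot> s" if "x \<in> X" for x
      proof (rule rho_least)
        fix w assume "w \<in> lstar P"
        then obtain t where "t \<in> U" "x \<boxdot> \<rho> {w} \<preceq> x \<boxdot> t" using word \<open>x \<in> X\<close> by blast
        then show "x \<boxdot> \<rho> {w} \<preceq> x \<boxdot> s" using s(2)[OF \<open>x \<in> X\<close>] le_trans by blast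
      qed
      then have "dominated X T (lstar P)" using s(1) unfolding dominated_def by blast
      then show ?thesis using star by (intro covered_single)
    next
      case False
      then obtain c where c: "c \<in> \<kappa> ` P" "(\<lambda>x. x \<boxdot> c) ` X \<noteq> X" by blast
      define C where "C = {w\<in>P. \<kappa> w = c}"
      let ?B = "P - C"
      let ?N = "lconc (lstar ?B) C"
      let ?X = "(\<lambda>x. x \<boxdot> c) ` X"
      let ?T = "insert e ((\<lambda>t. t \<boxdot> c) ` T)"
      have cT: "c \<in> T" using c(1) colT by blast
      have CP: "C \<subseteq> P" and CSF: "C \<in> SF G" using colSF by (auto simp: C_def)
      have XX: "?X \<subset> X" using c(2) act cT by blast
      have BSF: "lstar ?B \<in> SF G"
      proof -
        have "P - ?B = C" using CP by blast
        then have "lstar ?B = lstar P - lconc (lstar P) (lconc C (lstar P))"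
          using lstar_subset_code[OF P, of ?B] by simp
        then show ?thesis using star CSF by (simp add: ba_Diff[OF SF_ba] SF.SF_conc)
      qed
      \<comment> \<open>Without the blocks of colour \<open>c\<close> one colour fewer is used, so
        the inner induction hypothesis applies.\<close>
      have B: "covered (dominated X T) (lstar ?B)"
      proof (rule inner.hyps[of \<kappa> ?B])
        have "c \<notin> \<kappa> ` ?B" "\<kappa> ` ?B \<subseteq> \<kappa> ` P" by (auto simp: C_def)
        then show "card (\<kappa> ` ?B) < card (\<kappa> ` P)" using c(1) by (intro psubset_card_mono) auto
        have eq: "{w\<in>?B. \<kappa> w = t} = (if t = c then {} else {w\<in>P. \<kappa> w = t})" for t by (auto simp: C_def)
        show "coloured X T ?B \<kappa>" unfolding coloured_def eq
          using colT colSF colX by (simp add: ba_empty[OF SF_ba] image_subset_iff)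
      qed (use T act P BSF in \<open>auto intro: prefix_code_subset\<close>)
      have C: "covered (dominated X {c}) C"
        by (rule covered_single[OF CSF]) (use colX in \<open>simp add: dominated_def C_def\<close>)
      have NSF: "?N \<in> SF G" using BSF CSF by (rule SF.SF_conc)
      have Nstar: "lstar ?N \<in> SF G"
      proof -
        have "lstar ?N = {[]} \<union> lconc (lstar P) C" using lstar_marked[OF CP] by simp
        then show ?thesis using star CSF eps_SF by (metis SF.SF_conc SF.SF_union)
      qed
      have "covered (dominated X ((\<lambda>t. t \<boxdot> c) ` T)) ?N"
      proof (rule covered_lconc[OF B C])
        fix K L assume "dominated X T K" "dominated X {c} L"
        then show "dominated X ((\<lambda>t. t \<boxdot> c) ` T) (lconc K L)"
          by (rule dominated_lconc) (use act in auto)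
      qed
      note N = this
      \<comment> \<open>Restricting the left factors to \<open>?X\<close> and adding
        \<open>e\<close> to the bounds gives the form that the outer induction hypothesis
        takes.\<close>
      then have "covered (dominated ?X ?T) ?N"
      proof (rule covered_mono)
        show "dominated ?X ?T K" if "dominated X ((\<lambda>t. t \<boxdot> c) ` T) K" for K
          using that XX unfolding dominated_def by blast
      qed simp
      then obtain \<kappa>' where "coloured ?X ?T ?N \<kappa>'" using covered_coloured NSF by blast
      then have Nst: "covered (dominated ?X ?T) (lstar ?N)"
      proof (intro outer.hyps)
        show "card ?X < card X" using XX by (intro psubset_card_mono) auto
        show "stable ?T" using stable_local[OF T cT] .
        show "x \<boxdot> t \<in> ?X" if "x \<in> ?X" "t \<in> ?T" for x t
        proof -
          from that(1) obtain y where y: "y \<in> X" "x = y \<boxdot> c" by blast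
          show ?thesis using that(2)
          proof
            assume "t \<in> (\<lambda>t. t \<boxdot> c) ` T"
            then obtain u where "u \<in> T" "t = u \<boxdot> c" by blast
            then show ?thesis using y act cT by (auto simp: tm_assoc[symmetric])
          qed (use that(1) in simp)
        qed
        show "prefix_code ?N" using prefix_code_marked[OF P CP] .
      qed (use Nstar in auto)
      have T'T: "?T \<subseteq> T" using eT TT cT by auto
      \<comment> \<open>One marked block is split off in front: its bound ends in \<open>c\<close>
        and so leads from \<open>X\<close> into \<open>?X\<close>, where the star of the marked code
        is known to be dominated.\<close>
      have "covered (dominated X T) (lconc ?N (lconc (lstar ?N) (lstar ?B)))"
      proof (rule covered_lconc[OF N])
        show "covered (dominated ?X T) (lconc (lstar ?N) (lstar ?B))"
        proof (rule covered_lconc[OF Nst B])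
          fix K L assume "dominated ?X ?T K" "dominated X T L"
          then show "dominated ?X T (lconc K L)"
          proof (rule dominated_lconc)
            show "(\<lambda>x. x \<boxdot> t) ` ?X \<subseteq> X" if "t \<in> ?T" for t
              using that T'T XX act by blast
            show "t \<boxdot> u \<in> T" if "t \<in> ?T" "u \<in> T" for t u
              using that T'T TT by blast
          qed
        qed
        fix K L assume "dominated X ((\<lambda>t. t \<boxdot> c) ` T) K" "dominated ?X T L"
        then show "dominated X T (lconc K L)"
        proof (rule dominated_lconc)
          fix t u assume "t \<in> (\<lambda>t. t \<boxdot> c) ` T"
          then obtain v where v: "v \<in> T" "t = v \<boxdot> c" by blast
          then show "(\<lambda>x. x \<boxdot> t) ` X \<subseteq> ?X" using act by (auto simp: tm_assoc[symmetric])
          assume "u \<in> T"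
          then show "t \<boxdot> u \<in> T" using v TT cT by blast
        qed
      qed
      from covered_Un[OF B this] show ?thesis
      proof (rule covered_mono)
        show "lstar P \<subseteq> lstar ?B \<union> lconc ?N (lconc (lstar ?N) (lstar ?B))"
        proof
          fix w assume "w \<in> lstar P"
          then obtain n b where nb: "w = n @ b" "n \<in> lstar ?N" "b \<in> lstar ?B"
            using lstar_marked_decomp by blast
          from nb(2) show "w \<in> lstar ?B \<union> lconc ?N (lconc (lstar ?N) (lstar ?B))"
          proof cases
            case lstar_nil
            then show ?thesis using nb by simp
          next
            case (lstar_app u v)
            then have "u @ (v @ b) \<in> lconc ?N (lconc (lstar ?N) (lstar ?B))"
              using nb by (intro lconcI)
            then show ?thesis using nb lstar_app by simp
          qed
        qed
      qed
    qed
  qed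
qed

end

section \<open>Optimal identities and optimal covers\<close>

text \<open>An identity whose value has least cardinality is optimal: intersecting it with another
  identity cannot lower the cardinality, hence keeps the value. This justifies the description
  operator in \<open>iota\<close>.\<close>

lemma iota_optimal:
  fixes \<tau> :: "'a list set \<Rightarrow> 'r::finite set"
  assumes G: "lang_lattice G" and mono: "\<And>K L. K \<subseteq> L \<Longrightarrow> \<tau> K \<subseteq> \<tau> L"
  obtains L where "L \<in> G" "[] \<in> L" "iota G \<tau> = \<tau> L" "\<And>L'. L' \<in> G \<Longrightarrow> [] \<in> L' \<Longrightarrow> \<tau> L \<subseteq> \<tau> L'"
proof -
  have "UNIV \<in> G \<and> [] \<in> (UNIV :: 'a list set)" using G by (simp add: lang_lattice_def)
  from ex_has_least_nat[of "\<lambda>L. L \<in> G \<and> [] \<in> L", OF this, of "\<lambda>L. card (\<tau> L)"]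
  obtain L where L: "L \<in> G" "[] \<in> L" "\<And>L'. L' \<in> G \<Longrightarrow> [] \<in> L' \<Longrightarrow> card (\<tau> L) \<le> card (\<tau> L')"
    by blast
  have opt: "\<tau> L \<subseteq> \<tau> L'" if "L' \<in> G" "[] \<in> L'" for L'
  proof -
    have "L \<inter> L' \<in> G" "[] \<in> L \<inter> L'" using that L G by (auto simp: lang_lattice_def)
    then have "\<tau> (L \<inter> L') = \<tau> L" using L(3) mono[of "L \<inter> L'" L] by (intro card_seteq) auto
    then show ?thesis using mono[of "L \<inter> L'" L'] by simp
  qed
  moreover have "iota G \<tau> = \<tau> L"
    unfolding iota_def by (rule the_equality) (use L(1,2) opt in blast)+
  ultimately show thesis using that L by blast
qed

context rating
begin

text \<open>The argument of \<open>iota_optimal\<close>, with the pairwise intersections of two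
  covers as common refinement. The optimal imprint is thus the intersection of the imprints of all
  covers.\<close>

lemma opt_imprint_iff:
  assumes D: "lang_lattice D"
  shows "r \<in> opt_imprint D pl L \<rho> \<longleftrightarrow> (\<forall>KK. is_cover D L KK \<longrightarrow> (\<exists>K\<in>KK. r \<preceq> \<rho> K))"
proof -
  have "is_cover D L {UNIV}" using D by (simp add: is_cover_def lang_lattice_def)
  from ex_has_least_nat[of "is_cover D L", OF this, of "\<lambda>KK. card (imprint pl \<rho> KK)"]
  obtain KK where KK: "is_cover D L KK"
    "\<And>LL. is_cover D L LL \<Longrightarrow> card (imprint pl \<rho> KK) \<le> card (imprint pl \<rho> LL)" by blast
  have opt: "imprint pl \<rho> KK \<subseteq> imprint pl \<rho> LL" if LL: "is_cover D L LL" for LL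
  proof -
    let ?M = "(\<lambda>(A, B). A \<inter> B) ` (KK \<times> LL)"
    have "L \<subseteq> \<Union>?M"
    proof
      fix w assume "w \<in> L"
      then obtain A B where "A \<in> KK" "B \<in> LL" "w \<in> A" "w \<in> B"
        using KK(1) LL unfolding is_cover_def by blast
      then show "w \<in> \<Union>?M" by (auto intro!: bexI[of _ "(A, B)"])
    qed
    moreover have "finite ?M" using KK(1) LL by (simp add: is_cover_def)
    moreover have "?M \<subseteq> D"
    proof (clarify)
      fix A B assume "A \<in> KK" "B \<in> LL"
      then have "A \<in> D" "B \<in> D" using KK(1) LL unfolding is_cover_def by blast+
      then show "A \<inter> B \<in> D" using D unfolding lang_lattice_def by blast
    qed
    ultimately have "is_cover D L ?M" by (simp add: is_cover_def)
    then have "card (imprint pl \<rho> KK) \<le> card (imprint pl \<rho> ?M)" by (rule KK(2))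
    moreover have "imprint pl \<rho> ?M \<subseteq> imprint pl \<rho> KK \<inter> imprint pl \<rho> LL"
    proof
      fix q assume "q \<in> imprint pl \<rho> ?M"
      then obtain A B where AB: "A \<in> KK" "B \<in> LL" "q \<preceq> \<rho> (A \<inter> B)" by (auto simp: imprint_def)
      then have "q \<preceq> \<rho> A" "q \<preceq> \<rho> B"
        using le_trans[OF AB(3) rho_mono] by simp_all
      then show "q \<in> imprint pl \<rho> KK \<inter> imprint pl \<rho> LL" using AB by (auto simp: imprint_def)
    qed
    ultimately show ?thesis by (metis Int_subset_iff card_seteq finite)
  qed
  have "opt_imprint D pl L \<rho> = imprint pl \<rho> KK"
    unfolding opt_imprint_def by (rule the_equality) (use KK(1) opt in blast)+
  moreover have "r \<in> imprint pl \<rho> LL \<longleftrightarrow> (\<exists>K\<in>LL. r \<preceq> \<rho> K)" for LL by (simp add: imprint_def)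
  ultimately show ?thesis using KK(1) opt by blast
qed

end

section \<open>Covering a group language by loops in its Cayley graph\<close>

context rated_group_based
begin

context
  fixes S :: "'r set" and L0 :: "'a list set"
  assumes L0: "L0 \<in> G"
    and S_down: "\<And>q r. r \<in> S \<Longrightarrow> q \<preceq> r \<Longrightarrow> q \<in> S"
    and S_stable: "stable S"
    and S_mu: "mu tm e \<rho> S L0 \<subseteq> S" and eps_L0: "[] \<in> L0"
begin

text \<open>The vertices of the Cayley graph: reading \<open>u\<close> from \<open>cls p\<close>
  leads to \<open>cls (p @ u)\<close>.\<close>

abbreviation cls :: "'a list \<Rightarrow> 'a list set" where "cls \<equiv> syn {L0}"

text \<open>Labels of loops at the vertex \<open>cls p\<close> that avoid \<open>X\<close>,
  endpoints included. In a group a word labels a loop at one vertex iff it does at every vertex,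
  hence the condition \<open>w \<in> cls []\<close>.\<close>

definition loops :: "'a list \<Rightarrow> 'a list set set \<Rightarrow> 'a list set" where
  "loops p X = {w\<in>cls []. \<forall>u v. w = u @ v \<longrightarrow> cls (p @ u) \<notin> X}"

text \<open>First returns: nonempty loops that meet their base only at the two ends.\<close>

definition returns :: "'a list \<Rightarrow> 'a list set set \<Rightarrow> 'a list set" where
  "returns p X = {w\<in>loops p X. w \<noteq> [] \<and> (\<forall>u v. w = u @ v \<and> u \<in> cls [] \<longrightarrow> u = [] \<or> v = [])}"

text \<open>The end of the path is exempt from avoidance, since the target \<open>g\<close> will
  itself be a forbidden vertex.\<close>

definition paths :: "'a list \<Rightarrow> 'a list set set \<Rightarrow> 'a list set \<Rightarrow> 'a list set" where
  "paths p X g = {w. cls (p @ w) = g \<and> (\<forall>u v. w = u @ v \<and> v \<noteq> [] \<longrightarrow> cls (p @ u) \<notin> X)}"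

lemma cls_eps_left: "u \<in> cls [] \<Longrightarrow> cls (u @ v) = cls v"
  using syn_append_eq[of "{L0}" u "[]" v v] by (simp add: syn_eq_iff)

lemma cls_eps_mid: "u \<in> cls [] \<Longrightarrow> cls (p @ u @ v) = cls (p @ v)"
  by (intro syn_append_eq cls_eps_left) auto

lemma mu_word_S:
  assumes "v \<in> cls []" "m \<in> mu_word tm e \<rho> S v" shows "m \<in> S"
proof -
  have "v \<in> L0" using assms(1) syn_subset[of L0 "{L0}" "[]"] eps_L0 by blast
  then show ?thesis using assms(2) S_mu by (auto simp: mu_def)
qed

lemma mu_word_Cons:
  assumes "s \<in> S" "m \<in> mu_word tm e \<rho> S v"
  shows "s \<boxdot> \<rho> {[a]} \<boxdot> m \<in> mu_word tm e \<rho> S (a # v)"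
proof -
  \<comment> \<open>Of the two decorations of a letter only the left one varies; the right one is
    \<open>e\<close>.\<close>
  have "s \<boxdot> \<rho> {[a]} \<boxdot> e \<in> mu_letter tm \<rho> S a"
    using assms(1) S_stable unfolding mu_letter_def stable_def by blast
  then show ?thesis using assms(2) by (auto simp: setprod_def)
qed

text \<open>The words leading from \<open>p\<close> into \<open>X\<close> form a finite union of
  quotients of languages of \<open>G\<close>; a loop avoids \<open>X\<close> iff none of its
  prefixes is such a word.\<close>

lemma loops_SF:
  assumes "X \<subseteq> range cls" shows "loops p X \<in> SF G"
proof -
  have "{u. cls (p @ u) \<in> X} = (\<Union>q\<in>X. bquot p [] q)"
  proof (rule Set.set_eqI)
    fix u
    have "p @ u \<in> q \<longleftrightarrow> cls (p @ u) = q" if "q \<in> X" for q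
    proof -
      obtain w where "q = cls w" using assms \<open>q \<in> X\<close> by blast
      then show ?thesis by (simp add: syn_eq_iff)
    qed
    then show "u \<in> {u. cls (p @ u) \<in> X} \<longleftrightarrow> u \<in> (\<Union>q\<in>X. bquot p [] q)" by auto
  qed
  moreover have "(\<Union>q\<in>X. bquot p [] q) \<in> SF G"
  proof (rule ba_Union[OF SF_ba])
    show "finite ((\<lambda>q. bquot p [] q) ` X)" using G_syn(2)[OF L0] assms by (meson finite_imageI finite_subset)
    show "(\<lambda>q. bquot p [] q) ` X \<subseteq> SF G"
    proof (clarify)
      fix q assume "q \<in> X"
      then have "q \<in> G" using assms G_syn(1)[OF L0] by blast
      then have "bquot p [] q \<in> G" using G_bquots[of q] bquot_in_bquots by blast
      then show "bquot p [] q \<in> SF G" by (rule SF_base)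
    qed
  qed
  moreover have "loops p X = cls [] - lconc {u. cls (p @ u) \<in> X} UNIV"
    by (auto simp: loops_def lconc_def)
  ultimately show ?thesis
    using G_syn(1)[OF L0] by (simp add: ba_Diff[OF SF_ba] SF.SF_base SF.SF_conc ba_UNIV[OF SF_ba])
qed

lemma returns_SF:
  assumes "X \<subseteq> range cls" shows "returns p X \<in> SF G"
proof -
  have "returns p X = loops p X - {[]} - lconc (cls [] - {[]}) (UNIV - {[]})"
    by (auto simp: returns_def lconc_def)
  then show ?thesis using loops_SF[OF assms] G_syn(1)[OF L0, of "[]"] eps_SF
    by (simp add: ba_Diff[OF SF_ba] SF.SF_base SF.SF_conc ba_UNIV[OF SF_ba])
qed

lemma returns_code: "prefix_code (returns p X)"
  unfolding prefix_code_def returns_def loops_def by auto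

text \<open>A loop is cut at each visit to its base. The hypothesis on \<open>p\<close> makes the
  empty word a loop.\<close>

lemma lstar_returns:
  assumes p: "cls p \<notin> X"
  shows "lstar (returns p X) = loops p X"
proof
  have "w \<in> lstar (returns p X) \<Longrightarrow> w \<in> loops p X" for w
  proof (induction rule: lstar.induct)
    case lstar_nil
    then show ?case using p by (simp add: loops_def)
  next
    case (lstar_app u v)
    then have u: "u \<in> loops p X" "u \<in> cls []" by (auto simp: returns_def loops_def)
    have "u @ v \<in> cls []"
      using u lstar_app.IH syn_append[of u "{L0}" "[]" v "[]"] by (simp add: loops_def)
    moreover have "cls (p @ x) \<notin> X" if "u @ v = x @ y" for x y
    proof -
      obtain t where "u = x @ t \<or> x = u @ t \<and> v = t @ y"
        using \<open>u @ v = x @ y\<close> unfolding append_eq_append_conv2 by metis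
      then show ?thesis
      proof
        assume "u = x @ t"
        then show ?thesis using u by (auto simp: loops_def)
      next
        assume "x = u @ t \<and> v = t @ y"
        then show ?thesis using lstar_app.IH cls_eps_mid[OF u(2)] by (auto simp: loops_def)
      qed
    qed
    ultimately show ?case unfolding loops_def by blast
  qed
  then show "lstar (returns p X) \<subseteq> loops p X" by blast
next
  have "w \<in> loops p X \<Longrightarrow> w \<in> lstar (returns p X)" for w
  proof (induction "length w" arbitrary: w rule: less_induct)
    case less
    show ?case
    proof (cases "w = []")
      case True
      then show ?thesis by (simp add: lstar.lstar_nil)
    next
      case False
      \<comment> \<open>The least such \<open>n\<close> is the length of the first return.\<close>
      let ?Q = "\<lambda>n. n > 0 \<and> n \<le> length w \<and> take n w \<in> cls []"
      have "?Q (length w)" using False less.prems by (auto simp: loops_def)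
      then have Q: "?Q (LEAST n. ?Q n)" by (rule LeastI)
      define n where "n = (LEAST n. ?Q n)"
      have n: "n > 0" "n \<le> length w" "take n w \<in> cls []" using Q by (auto simp: n_def)
      have least: "\<not> ?Q m" if "m < n" for m using that not_less_Least n_def by blast
      let ?u = "take n w" and ?v = "drop n w"
      have pre: "cls (p @ x) \<notin> X" if "w = x @ y" for x y using less.prems that by (auto simp: loops_def)
      have "?u \<in> returns p X"
      proof -
        have "cls (p @ x) \<notin> X" if "?u = x @ y" for x y
          using pre[of x "y @ ?v"] that by (metis append.assoc append_take_drop_id)
        moreover have "x = [] \<or> y = []" if "?u = x @ y" "x \<in> cls []" for x y
        proof (rule ccontr)
          assume xy: "\<not> (x = [] \<or> y = [])"
          have len: "length x + length y = n" using that(1) n(2) by (metis length_append length_take min.absorb2)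
          have "x = take (length x) w" using that(1) len
            by (metis append_eq_conv_conj le_add1 min.absorb2 take_take min.commute)
          then have "?Q (length x)" using xy len n that(2) by auto
          then show False using least[of "length x"] len xy by auto
        qed
        ultimately show ?thesis using n False by (auto simp: returns_def loops_def)
      qed
      moreover have "?v \<in> loops p X"
      proof -
        have "cls ?v = cls w" using cls_eps_left[OF n(3), of ?v] by simp
        then have "?v \<in> cls []" using less.prems by (simp add: loops_def syn_eq_iff[symmetric])
        moreover have "cls (p @ x) \<notin> X" if "?v = x @ y" for x y
          using pre[of "?u @ x" y] that cls_eps_mid[OF n(3), of p x] by (metis append.assoc append_take_drop_id)
        ultimately show ?thesis unfolding loops_def by blast
      qed
      then have "?v \<in> lstar (returns p X)" using n by (intro less.hyps) auto
      ultimately have "?u @ ?v \<in> lstar (returns p X)" by (rule lstar.lstar_app)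
      then show ?thesis by simp
    qed
  qed
  then show "loops p X \<subseteq> lstar (returns p X)" by blast
qed

text \<open>\<open>lstar_covered\<close> is applied with \<open>S\<close> acting on itself. As
  \<open>e\<close> is among the left factors, domination bounds the rating by an element of
  \<open>S\<close>, and downward closure puts the rating into \<open>S\<close>.\<close>

lemma loops_covered_if_returns:
  assumes "X \<subseteq> range cls" "cls p \<notin> X" "covered (\<lambda>K. \<rho> K \<in> S) (returns p X)"
  shows "covered (\<lambda>K. \<rho> K \<in> S) (loops p X)"
proof -
  have SS: "\<And>s t. s \<in> S \<Longrightarrow> t \<in> S \<Longrightarrow> s \<boxdot> t \<in> S" and eS: "e \<in> S"
    using S_stable unfolding stable_def by blast+
  have "covered (dominated S S) (returns p X)"
    using assms(3) by (rule covered_mono) (auto simp: dominated_def intro: le_refl)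
  then obtain \<kappa> where \<kappa>: "coloured S S (returns p X) \<kappa>" using covered_coloured returns_SF assms(1) by blast
  have "covered (dominated S S) (lstar (returns p X))"
  proof (rule lstar_covered[OF S_stable _ returns_code \<kappa>])
    show "s \<boxdot> t \<in> S" if "s \<in> S" "t \<in> S" for s t using SS that .
    show "lstar (returns p X) \<in> SF G" using lstar_returns[OF assms(2)] loops_SF[OF assms(1)] by simp
  qed
  then have "covered (dominated S S) (loops p X)" using lstar_returns[OF assms(2)] by simp
  then show ?thesis
  proof (rule covered_mono)
    fix K assume "dominated S S K"
    then obtain t where "t \<in> S" "e \<boxdot> \<rho> K \<preceq> e \<boxdot> t" using eS unfolding dominated_def by blast
    then show "\<rho> K \<in> S" using S_down by simp
  qed simp
qed

text \<open>The bound is a value of \<open>mu_word\<close> on the label \<open>v\<close> of some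
  path from \<open>cls p\<close> to \<open>g\<close>; \<open>v\<close> need not belong to
  \<open>K\<close>. Once the path is closed to a loop, its label lies in \<open>cls []\<close>, so
  the bound is in \<open>S\<close> by \<open>mu_word_S\<close>.\<close>

definition path_rated :: "'a list \<Rightarrow> 'a list set \<Rightarrow> 'a list set \<Rightarrow> bool" where
  "path_rated p g K \<longleftrightarrow> (\<exists>v m. cls (p @ v) = g \<and> m \<in> mu_word tm e \<rho> S v \<and> \<rho> K \<preceq> m)"

text \<open>Behind its first letter, a first return is a path back to \<open>cls p\<close> that
  meets neither \<open>X\<close> nor \<open>cls p\<close> before its end.\<close>

lemma returns_covered:
  assumes "\<And>a. cls (p @ [a]) \<notin> insert (cls p) X \<Longrightarrow>
      covered (path_rated (p @ [a]) (cls p)) (paths (p @ [a]) (insert (cls p) X) (cls p))"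
  shows "covered (\<lambda>K. \<rho> K \<in> S) (returns p X)"
proof -
  have eS: "e \<in> S" using S_stable unfolding stable_def by blast
  define R where "R a = (if cls (p @ [a]) = cls p then {[]}
    else if cls (p @ [a]) \<in> X then {} else paths (p @ [a]) (insert (cls p) X) (cls p))" for a
  have "covered (\<lambda>K. \<rho> K \<in> S) (\<Union>a. lconc {[a]} (R a))"
  proof (rule covered_UN)
    fix a :: 'a
    have "covered (\<lambda>K. K = {[a]}) {[a]}" by (intro covered_single SF_letter) simp
    moreover have "covered (path_rated (p @ [a]) (cls p)) (R a)"
    proof -
      have "covered (path_rated (p @ [a]) (cls p)) {[]}" if "cls (p @ [a]) = cls p"
        using that by (intro covered_single eps_SF) (auto simp: path_rated_def intro!: exI[of _ "[]"])
      then show ?thesis using assms[of a] covered_empty by (auto simp: R_def)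
    qed
    ultimately show "covered (\<lambda>K. \<rho> K \<in> S) (lconc {[a]} (R a))"
    proof (rule covered_lconc)
      fix A B assume A: "A = {[a]}" and "path_rated (p @ [a]) (cls p) B"
      then obtain v m where v: "cls (p @ [a] @ v) = cls p" "m \<in> mu_word tm e \<rho> S v" "\<rho> B \<preceq> m"
        unfolding path_rated_def by auto
      \<comment> \<open>The letter closes \<open>v\<close> to a loop, which turns the bound into an
        element of \<open>S\<close>.\<close>
      have "[a] @ v \<in> cls []" using G_syn_cancel[OF L0 v(1)] .
      then have "e \<boxdot> \<rho> {[a]} \<boxdot> m \<in> S" using mu_word_Cons[OF eS v(2)] mu_word_S by simp
      moreover have "\<rho> (lconc A B) \<preceq> \<rho> {[a]} \<boxdot> m" unfolding rho_lconc A using v(3) by (intro tm_mono) auto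
      ultimately show "\<rho> (lconc A B) \<in> S" using S_down by simp
    qed
  qed simp
  then show ?thesis
  proof (rule covered_mono)
    show "returns p X \<subseteq> (\<Union>a. lconc {[a]} (R a))"
    proof
      fix w assume w: "w \<in> returns p X"
      then obtain a r where ar: "w = a # r" by (cases w) (auto simp: returns_def)
      have wL: "w \<in> cls []" and pre: "\<And>u v. w = u @ v \<Longrightarrow> cls (p @ u) \<notin> X"
        and first: "\<And>u v. w = u @ v \<Longrightarrow> u \<in> cls [] \<Longrightarrow> u = [] \<or> v = []"
        using w by (auto simp: returns_def loops_def)
      have notp: "cls (p @ a # u) \<noteq> cls p" if "r = u @ v" "v \<noteq> []" for u v
      proof
        assume "cls (p @ a # u) = cls p"
        then have "a # u \<in> cls []" by (rule G_syn_cancel[OF L0])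
        then show False using first[of "a # u" v] that ar by simp
      qed
      have "r \<in> R a"
      proof (cases "cls (p @ [a]) = cls p")
        case True
        then have "r = []" using notp[of "[]" r] by auto
        then show ?thesis using True by (simp add: R_def)
      next
        case False
        have "cls (p @ [a]) \<notin> X" using pre[of "[a]" r] ar by simp
        moreover have "r \<in> paths (p @ [a]) (insert (cls p) X) (cls p)"
        proof -
          have "cls (p @ w) = cls p" using cls_eps_mid[OF wL, of p "[]"] by simp
          moreover have "cls (p @ a # u) \<notin> insert (cls p) X" if "r = u @ v" "v \<noteq> []" for u v
            using notp[OF that] pre[of "a # u" v] that ar by simp
          ultimately show ?thesis using ar by (simp add: paths_def) blast
        qed
        ultimately show ?thesis using False by (simp add: R_def)
      qed
      then show "w \<in> (\<Union>a. lconc {[a]} (R a))" using lconcI[of "[a]" "{[a]}" r "R a"] ar by auto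
    qed
  qed
qed

text \<open>A path is split at its last visit to \<open>cls p\<close>: a loop, a letter and a path
  that no longer meets \<open>cls p\<close>. The rating of the loop becomes the left decoration of
  the letter, so the bound is again a value of \<open>mu_word\<close>.\<close>

lemma paths_covered:
  assumes p: "cls p \<notin> X" and g: "g \<in> X"
    and L: "covered (\<lambda>K. \<rho> K \<in> S) (loops p X)"
    and IH: "\<And>a. cls (p @ [a]) \<notin> insert (cls p) X \<Longrightarrow>
      covered (path_rated (p @ [a]) g) (paths (p @ [a]) (insert (cls p) X) g)"
  shows "covered (path_rated p g) (paths p X g)"
proof -
  \<comment> \<open>The test for \<open>g\<close> comes first because \<open>g\<close> itself lies
    in \<open>X\<close>.\<close>
  define R where "R a = (if cls (p @ [a]) = g then {[]}
    else if cls (p @ [a]) \<in> insert (cls p) X then {} else paths (p @ [a]) (insert (cls p) X) g)" for a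
  have "covered (path_rated p g) (\<Union>a. lconc (loops p X) (lconc {[a]} (R a)))"
  proof (rule covered_UN)
    fix a :: 'a
    have "covered (\<lambda>K. K = {[a]}) {[a]}" by (intro covered_single SF_letter) simp
    moreover have "covered (path_rated (p @ [a]) g) (R a)"
    proof -
      have "covered (path_rated (p @ [a]) g) {[]}" if "cls (p @ [a]) = g"
        using that by (intro covered_single eps_SF) (auto simp: path_rated_def intro!: exI[of _ "[]"])
      then show ?thesis using IH[of a] covered_empty by (auto simp: R_def)
    qed
    ultimately have "covered (\<lambda>K. \<exists>B. path_rated (p @ [a]) g B \<and> K = lconc {[a]} B) (lconc {[a]} (R a))"
      by (rule covered_lconc) auto
    with L show "covered (path_rated p g) (lconc (loops p X) (lconc {[a]} (R a)))"
    proof (rule covered_lconc)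
      fix A K assume A: "\<rho> A \<in> S" and "\<exists>B. path_rated (p @ [a]) g B \<and> K = lconc {[a]} B"
      then obtain B v m where v: "cls (p @ a # v) = g" "m \<in> mu_word tm e \<rho> S v" "\<rho> B \<preceq> m" "K = lconc {[a]} B"
        unfolding path_rated_def by auto
      have "\<rho> A \<boxdot> \<rho> {[a]} \<boxdot> m \<in> mu_word tm e \<rho> S (a # v)" using mu_word_Cons[OF A v(2)] .
      moreover have "\<rho> (lconc A K) \<preceq> \<rho> A \<boxdot> \<rho> {[a]} \<boxdot> m"
        unfolding v(4) rho_lconc tm_assoc using v(3) by (intro tm_mono) auto
      ultimately show "path_rated p g (lconc A K)" using v(1) unfolding path_rated_def by blast
    qed
  qed simp
  then show ?thesis
  proof (rule covered_mono)
    show "paths p X g \<subseteq> (\<Union>a. lconc (loops p X) (lconc {[a]} (R a)))"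
    proof
      fix w assume "w \<in> paths p X g"
      then have wg: "cls (p @ w) = g" and pre: "\<And>u v. w = u @ v \<Longrightarrow> v \<noteq> [] \<Longrightarrow> cls (p @ u) \<notin> X"
        by (auto simp: paths_def)
      \<comment> \<open>The greatest such \<open>n\<close> marks the last visit to
        \<open>cls p\<close>.\<close>
      let ?Q = "\<lambda>n. n \<le> length w \<and> cls (p @ take n w) = cls p"
      have "?Q 0" by simp
      then have Q: "?Q (GREATEST n. ?Q n)" by (rule GreatestI_nat[where b = "length w"]) simp
      define n where "n = (GREATEST n. ?Q n)"
      have n: "n \<le> length w" "cls (p @ take n w) = cls p" using Q by (auto simp: n_def)
      have greatest: "m \<le> n" if "?Q m" for m
        unfolding n_def using that by (intro Greatest_le_nat[where b = "length w"]) auto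
      let ?l = "take n w"
      have l: "?l \<in> cls []" using G_syn_cancel[OF L0 n(2)] .
      \<comment> \<open>The path cannot end at this visit: its end \<open>g\<close> is in
        \<open>X\<close> and \<open>cls p\<close> is not.\<close>
      have "drop n w \<noteq> []"
      proof
        assume "drop n w = []"
        then have "take n w = w" by simp
        then show False using n(2) wg p g by simp
      qed
      then obtain a r where ar: "drop n w = a # r" by (cases "drop n w") auto
      have w: "w = ?l @ a # r" using ar by (metis append_take_drop_id)
      have notp: "cls (p @ a # u) \<noteq> cls p" if "r = u @ v" for u v
      proof
        assume "cls (p @ a # u) = cls p"
        then have "cls (p @ ?l @ a # u) = cls p" using cls_eps_mid[OF l] by simp
        moreover have "?l @ a # u = take (n + Suc (length u)) w" "n + Suc (length u) \<le> length w"
        proof -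
          have len: "length ?l = n" using n(1) by simp
          have w': "w = (?l @ a # u) @ v" using w that by simp
          have "length (?l @ a # u) = n + Suc (length u)" using len by simp
          then show "?l @ a # u = take (n + Suc (length u)) w" "n + Suc (length u) \<le> length w"
            using w' by (metis append_eq_conv_conj, metis length_append le_add1)
        qed
        ultimately have "n + Suc (length u) \<le> n" by (intro greatest) simp
        then show False by simp
      qed
      have "?l \<in> loops p X"
      proof -
        have "cls (p @ u) \<notin> X" if "?l = u @ v" for u v
          using pre[of u "v @ a # r"] that w by (metis Nil_is_append_conv append.assoc list.discI)
        then show ?thesis using l by (auto simp: loops_def)
      qed
      moreover have "r \<in> R a"
      proof (cases "cls (p @ [a]) \<in> X")
        case True
        have "r = []"
        proof (rule ccontr)
          assume "r \<noteq> []"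
          then have "cls (p @ ?l @ [a]) \<notin> X" using pre[of "?l @ [a]" r] w by simp
          then show False using True cls_eps_mid[OF l] by simp
        qed
        then have "cls (p @ [a]) = g" using wg w cls_eps_mid[OF l, of p "[a]"] by metis
        then show ?thesis using \<open>r = []\<close> by (simp add: R_def)
      next
        case False
        have "cls (p @ a # r) = g" using wg w cls_eps_mid[OF l, of p "a # r"] by metis
        moreover have "cls (p @ a # u) \<notin> insert (cls p) X" if "r = u @ v" "v \<noteq> []" for u v
        proof -
          have "cls (p @ ?l @ a # u) \<notin> X" using pre[of "?l @ a # u" v] w that by simp
          then show ?thesis using notp[OF that(1)] cls_eps_mid[OF l] by simp
        qed
        ultimately have "r \<in> paths (p @ [a]) (insert (cls p) X) g" by (simp add: paths_def) blast
        moreover have "cls (p @ [a]) \<noteq> cls p" using notp[of "[]" r] by simp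
        ultimately show ?thesis using False g by (auto simp: R_def)
      qed
      then have "[a] @ r \<in> lconc {[a]} (R a)" by (intro lconcI) auto
      ultimately have "?l @ [a] @ r \<in> lconc (loops p X) (lconc {[a]} (R a))" by (rule lconcI)
      then show "w \<in> (\<Union>a. lconc (loops p X) (lconc {[a]} (R a)))" using w by auto
    qed
  qed
qed

text \<open>Leaving \<open>cls p\<close> for good forbids this vertex, so the number of available
  vertices drops. First returns need paths with target \<open>cls p\<close>, and paths need the
  loops for the same \<open>X\<close>, so both are proved in one induction.\<close>

lemma loops_and_paths_covered:
  assumes "X \<subseteq> range cls" "cls p \<notin> X"
  shows "covered (\<lambda>K. \<rho> K \<in> S) (loops p X) \<and> (\<forall>g\<in>X. covered (path_rated p g) (paths p X g))"
  using assms
proof (induction "card (range cls - X)" arbitrary: X p rule: less_induct)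
  case less
  have IH: "covered (path_rated (p @ [a]) g) (paths (p @ [a]) (insert (cls p) X) g)"
    if "cls (p @ [a]) \<notin> insert (cls p) X" "g \<in> insert (cls p) X" for a g
  proof -
    have "card (range cls - insert (cls p) X) < card (range cls - X)"
      using less.prems G_syn(2)[OF L0] by (intro psubset_card_mono) auto
    then show ?thesis using less.hyps[of "insert (cls p) X" "p @ [a]"] less.prems that by auto
  qed
  have "covered (\<lambda>K. \<rho> K \<in> S) (loops p X)"
    by (intro loops_covered_if_returns less.prems returns_covered IH) auto
  then show ?case using paths_covered[OF less.prems(2)] IH by blast
qed

lemma identity_covered: "covered (\<lambda>K. \<rho> K \<in> S) (cls [])"
proof -
  have "loops [] {} = cls []" by (simp add: loops_def)
  then show ?thesis using loops_and_paths_covered[of "{}" "[]"] by simp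
qed

end

end

section \<open>Completeness of the optimal imprint\<close>

context rated_group_based
begin

abbreviation \<tau> :: "'a list set \<Rightarrow> 'r set" where
  "\<tau> K \<equiv> opt_imprint (SF G) pl K \<rho>"

lemmas tau_iff = opt_imprint_iff[OF SF_lattice]

lemma tau_mono: "K \<subseteq> L \<Longrightarrow> \<tau> K \<subseteq> \<tau> L"
  unfolding subset_iff tau_iff is_cover_def by (meson subset_trans subsetI)

lemma tau_down: "r \<in> \<tau> K \<Longrightarrow> q \<preceq> r \<Longrightarrow> q \<in> \<tau> K"
  unfolding tau_iff using le_trans by blast

lemma rho_in_tau: "w \<in> K \<Longrightarrow> \<rho> {w} \<in> \<tau> K"
proof -
  assume w: "w \<in> K"
  show ?thesis unfolding tau_iff
  proof (intro allI impI)
    fix KK assume "is_cover (SF G) K KK"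
    then obtain H where "H \<in> KK" "w \<in> H" using w unfolding is_cover_def by blast
    then show "\<exists>H\<in>KK. \<rho> {w} \<preceq> \<rho> H" using rho_mono[of "{w}" H] by blast
  qed
qed

text \<open>The classes of the words of \<open>K\<close> form a cover, so \<open>r\<close> lies
  below the rating of one of them. These classes refine all members of \<open>KK\<close> and, unlike
  these, multiply into each other.\<close>

lemma tau_syn:
  assumes "r \<in> \<tau> K" "finite KK" "KK \<subseteq> SF G"
  obtains w where "w \<in> K" "r \<preceq> \<rho> (syn KK w)"
proof -
  have "finite (syn KK ` K)" using SF_syn(2)[OF assms(2,3)] by (rule finite_subset[rotated]) blast
  moreover have "K \<subseteq> \<Union>(syn KK ` K)" by auto
  ultimately have "is_cover (SF G) K (syn KK ` K)"
    using SF_syn(1)[OF assms(2,3)] unfolding is_cover_def by blast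
  then show thesis using assms(1) that unfolding tau_iff by blast
qed

text \<open>The given cover of the product supplies the congruence: the classes of the witnesses
  \<open>u\<close> and \<open>v\<close> multiply into the class of \<open>u @ v\<close>, which lies
  in a member of the cover.\<close>

lemma tau_lconc:
  assumes "r \<in> \<tau> K" "s \<in> \<tau> L" shows "r \<boxdot> s \<in> \<tau> (lconc K L)"
  unfolding tau_iff
proof (intro allI impI)
  fix HH assume HH: "is_cover (SF G) (lconc K L) HH"
  then have fin: "finite HH" "HH \<subseteq> SF G" by (auto simp: is_cover_def)
  obtain u where u: "u \<in> K" "r \<preceq> \<rho> (syn HH u)" using tau_syn[OF assms(1) fin] .
  obtain v where v: "v \<in> L" "s \<preceq> \<rho> (syn HH v)" using tau_syn[OF assms(2) fin] .
  obtain H where H: "H \<in> HH" "u @ v \<in> H" using HH lconcI[OF u(1) v(1)] unfolding is_cover_def by blast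
  have "r \<boxdot> s \<preceq> \<rho> (lconc (syn HH u) (syn HH v))" unfolding rho_lconc using u(2) v(2) by (rule tm_mono)
  also have "\<rho> (lconc (syn HH u) (syn HH v)) \<preceq> \<rho> H"
    using lconc_syn syn_subset[OF H] by (intro rho_mono) (rule order_trans)
  finally show "\<exists>H\<in>HH. r \<boxdot> s \<preceq> \<rho> H" using H(1) by blast
qed

lemma pow_syn: "r \<preceq> \<rho> (syn HH w) \<Longrightarrow> pow r n \<preceq> \<rho> (syn HH (wpow w n))"
proof (induction n)
  case 0
  have "\<rho> {[]} \<preceq> \<rho> (syn HH [])" by (rule rho_mono) simp
  then show ?case by simp
next
  case (Suc n)
  have "r \<boxdot> pow r n \<preceq> \<rho> (lconc (syn HH w) (syn HH (wpow w n)))"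
    unfolding rho_lconc using Suc by (intro tm_mono) auto
  also have "\<rho> (lconc (syn HH w) (syn HH (wpow w n))) \<preceq> \<rho> (syn HH (wpow w (Suc n)))"
    using lconc_syn[of HH w "wpow w n"] by (intro rho_mono) simp
  finally show ?case by (simp add: pow_Suc)
qed

lemma SF_aperiodic_finite:
  assumes "finite HH" "HH \<subseteq> SF G"
  shows "\<exists>L\<in>G. \<exists>k. [] \<in> L \<and> (\<forall>H\<in>HH. aperiodic_on L k H)"
  using assms
proof (induction rule: finite_induct)
  case empty
  show ?case using ba_UNIV[OF G_ba] by blast
next
  case (insert H HH)
  then obtain L1 k1 where 1: "L1 \<in> G" "[] \<in> L1" "\<And>H. H \<in> HH \<Longrightarrow> aperiodic_on L1 k1 H" by auto
  obtain L2 k2 where 2: "L2 \<in> G" "[] \<in> L2" "aperiodic_on L2 k2 H" using SF_aperiodic[of H] insert.prems by blast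
  have "aperiodic_on (L1 \<inter> L2) (max k1 k2) H'" if "H' \<in> insert H HH" for H'
  proof (cases "H' = H")
    case True
    then show ?thesis using aperiodic_on_mono[OF 2(3)] by simp
  next
    case False
    then show ?thesis using aperiodic_on_mono[OF 1(3)] that by simp
  qed
  then show ?case using ba_Int[OF G_ba 1(1) 2(1)] 1(2) 2(2) by blast
qed

lemma mu_mono: "K \<subseteq> L \<Longrightarrow> mu tm e \<rho> S K \<subseteq> mu tm e \<rho> S L"
  by (auto simp: mu_def)

lemma iota_SF_complete: "SF_complete G pl tm e \<omega> \<rho> (iota G \<tau>)"
proof -
  obtain L1 where L1: "L1 \<in> G" "[] \<in> L1" "iota G \<tau> = \<tau> L1"
    "\<And>L'. L' \<in> G \<Longrightarrow> [] \<in> L' \<Longrightarrow> \<tau> L1 \<subseteq> \<tau> L'"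
    using iota_optimal[OF G_lattice, of \<tau>] tau_mono by metis
  \<comment> \<open>This class is still an optimal identity, and every class absorbs it under
    concatenation.\<close>
  define L where "L = syn {L1} []"
  have L: "L \<in> G" "[] \<in> L" using G_syn(1)[OF L1(1)] by (auto simp: L_def)
  have "L \<subseteq> L1" unfolding L_def using syn_subset L1(2) by blast
  then have TL: "iota G \<tau> = \<tau> L" using L1 L tau_mono by blast
  have insert_L: "lconc L (syn {L1} w) \<subseteq> syn {L1} w" "lconc (syn {L1} w) L \<subseteq> syn {L1} w" for w
    using lconc_syn[of "{L1}" "[]" w] lconc_syn[of "{L1}" w "[]"] by (simp_all add: L_def)
  have mul: "q \<boxdot> r \<in> \<tau> L" if "q \<in> \<tau> L" "r \<in> \<tau> L" for q r
    using tau_lconc[OF that] tau_mono[OF insert_L(1)[of "[]"]] unfolding L_def by blast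
  \<comment> \<open>Decorations from \<open>\<tau> L\<close> stand for words of \<open>L\<close>,
    whose insertion does not change the class of \<open>w\<close>. For \<open>w\<close> in
    \<open>L\<close> this class is \<open>L\<close> itself.\<close>
  have mu_word: "m \<in> mu_word tm e \<rho> (\<tau> L) w \<Longrightarrow> m \<in> \<tau> (syn {L1} w)" for m w
  proof (induction w arbitrary: m)
    case Nil
    then show ?case using rho_in_tau[of "[]" "syn {L1} []"] by simp
  next
    case (Cons a w)
    then obtain s s' m' where m: "m = s \<boxdot> \<rho> {[a]} \<boxdot> s' \<boxdot> m'" "s \<in> \<tau> L" "s' \<in> \<tau> L" "m' \<in> \<tau> (syn {L1} w)"
      by (auto simp: setprod_def mu_letter_def)
    have "\<rho> {[a]} \<in> \<tau> (syn {L1} [a])" by (rule rho_in_tau) simp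
    then have "m \<in> \<tau> (lconc (lconc (lconc L (syn {L1} [a])) L) (syn {L1} w))"
      unfolding m(1) using m(2-4) by (intro tau_lconc)
    moreover have "lconc (lconc (lconc L (syn {L1} [a])) L) (syn {L1} w) \<subseteq> lconc (syn {L1} [a]) (syn {L1} w)"
      using insert_L by (meson lconc_mono order_refl order_trans)
    moreover have "lconc (syn {L1} [a]) (syn {L1} w) \<subseteq> syn {L1} (a # w)"
      using lconc_syn[of "{L1}" "[a]" w] by simp
    ultimately show ?case using tau_mono by blast
  qed
  have iota_mu: "iota G (mu tm e \<rho> (\<tau> L)) \<subseteq> \<tau> L"
  proof -
    obtain M where M: "iota G (mu tm e \<rho> (\<tau> L)) = mu tm e \<rho> (\<tau> L) M"
      "\<And>L'. L' \<in> G \<Longrightarrow> [] \<in> L' \<Longrightarrow> mu tm e \<rho> (\<tau> L) M \<subseteq> mu tm e \<rho> (\<tau> L) L'"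
      using iota_optimal[OF G_lattice, of "mu tm e \<rho> (\<tau> L)"] mu_mono by metis
    have "mu tm e \<rho> (\<tau> L) L \<subseteq> \<tau> L"
    proof
      fix m assume "m \<in> mu tm e \<rho> (\<tau> L) L"
      then obtain w where w: "w \<in> L" "m \<in> mu_word tm e \<rho> (\<tau> L) w" by (auto simp: mu_def)
      then have "syn {L1} w = L" by (simp add: L_def syn_eq_iff)
      then show "m \<in> \<tau> L" using mu_word[OF w(2)] by simp
    qed
    then show ?thesis using M(1) M(2)[OF L] by blast
  qed
  \<comment> \<open>By optimality \<open>r\<close> survives in the smaller identity on whose words
    the cover \<open>HH\<close> is aperiodic. For a witness \<open>w\<close> there, two consecutive
    high powers are equivalent, so one member of \<open>HH\<close> lies above both summands.\<close>
  have "pow r \<omega> \<boxplus> pow r (\<omega> + 1) \<in> \<tau> L" if r: "r \<in> \<tau> L" for r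
    unfolding tau_iff
  proof (intro allI impI)
    fix HH assume HH: "is_cover (SF G) L HH"
    then have fin: "finite HH" "HH \<subseteq> SF G" by (auto simp: is_cover_def)
    obtain L2 k where L2: "L2 \<in> G" "[] \<in> L2" "\<And>H. H \<in> HH \<Longrightarrow> aperiodic_on L2 k H"
      using SF_aperiodic_finite[OF fin] by blast
    have "L \<inter> L2 \<in> G" "[] \<in> L \<inter> L2" using L L2 ba_Int[OF G_ba] by auto
    then have "r \<in> \<tau> (L \<inter> L2)" using r TL L1(3,4) by blast
    then obtain w where w: "w \<in> L" "w \<in> L2" "r \<preceq> \<rho> (syn HH w)" using tau_syn[OF _ fin] by blast
    \<comment> \<open>A multiple of \<open>\<omega>\<close>, so that the power of \<open>r\<close>
      is idempotent, and large enough for the threshold \<open>k\<close>.\<close>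
    define n where "n = Suc k * \<omega>"
    have n: "n \<ge> k" using omega_pos by (cases \<omega>) (auto simp: n_def)
    have pows: "pow r n = pow r \<omega>" "pow r (Suc n) = pow r (\<omega> + 1)"
      using pow_omega_mult[of "Suc k" r] by (simp_all add: n_def pow_Suc)
    have "x @ wpow w (Suc n) @ y \<in> H \<longleftrightarrow> x @ wpow w n @ y \<in> H" if "H \<in> HH" for H x y
      using aperiodic_onD[OF L2(3)[OF that] w(2) n] by blast
    then have "wpow w (Suc n) \<in> syn HH (wpow w n)" unfolding syn_def by (intro CollectI ballI allI)
    then have "syn HH (wpow w (Suc n)) = syn HH (wpow w n)" by (simp only: syn_eq_iff)
    then have "pow r \<omega> \<boxplus> pow r (\<omega> + 1) \<preceq> \<rho> (syn HH (wpow w n))"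
      using pow_syn[OF w(3), of n] pow_syn[OF w(3), of "Suc n"] pows by (metis pl_least)
    moreover have "wpow w m \<in> L" for m
    proof (induction m)
      case (Suc m)
      then show ?case using syn_append[of w "{L1}" "[]" "wpow w m" "[]"] w(1) by (simp add: L_def)
    qed (simp add: L_def)
    then obtain H where H: "H \<in> HH" "wpow w n \<in> H" using HH unfolding is_cover_def by blast
    ultimately show "\<exists>H\<in>HH. pow r \<omega> \<boxplus> pow r (\<omega> + 1) \<preceq> \<rho> H"
      using le_trans rho_mono[OF syn_subset[OF H]] by blast
  qed
  then show ?thesis unfolding SF_complete_def TL using tau_down mul iota_mu by blast
qed

text \<open>On an optimal identity for \<open>mu\<close>, completeness keeps all values in
  \<open>S\<close>. The class of \<open>[]\<close> for it is again a \<open>G\<close>-identity and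
  has a cover rated in \<open>S\<close>, whose imprint is in \<open>S\<close> by downward
  closure.\<close>

lemma iota_least:
  assumes S: "SF_complete G pl tm e \<omega> \<rho> S"
  shows "iota G \<tau> \<subseteq> S"
proof -
  obtain L0 where L0: "L0 \<in> G" "[] \<in> L0" "iota G (mu tm e \<rho> S) = mu tm e \<rho> S L0"
    using iota_optimal[OF G_lattice, of "mu tm e \<rho> S"] mu_mono by metis
  have mu: "mu tm e \<rho> S L0 \<subseteq> S" using S L0(3) unfolding SF_complete_def by simp
  \<comment> \<open>\<open>e\<close> enters \<open>S\<close> as the value of \<open>mu_word\<close>
    on the empty word.\<close>
  have "e \<in> mu tm e \<rho> S L0" unfolding mu_def using L0(2) by (intro UN_I[of "[]"]) auto
  then have "stable S" using S mu unfolding SF_complete_def stable_def by blast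
  moreover have down: "\<And>q r. r \<in> S \<Longrightarrow> q \<preceq> r \<Longrightarrow> q \<in> S" using S unfolding SF_complete_def by blast
  ultimately have "covered (\<lambda>K. \<rho> K \<in> S) (syn {L0} [])" using L0 mu by (intro identity_covered)
  then obtain KK where KK: "is_cover (SF G) (syn {L0} []) KK" "\<And>K. K \<in> KK \<Longrightarrow> \<rho> K \<in> S"
    unfolding covered_def by blast
  have "\<tau> (syn {L0} []) \<subseteq> S" using KK down unfolding subset_iff tau_iff by blast
  moreover obtain L1 where "iota G \<tau> = \<tau> L1" "\<And>L'. L' \<in> G \<Longrightarrow> [] \<in> L' \<Longrightarrow> \<tau> L1 \<subseteq> \<tau> L'"
    using iota_optimal[OF G_lattice, of \<tau>] tau_mono by metis
  ultimately show ?thesis using G_syn(1)[OF L0(1)] syn_refl by blast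
qed

end

theorem theorem10p6:
  fixes G :: "('a::finite) list set set"
    and \<rho> :: "'a list set \<Rightarrow> ('r::finite)"
    and pl tm :: "'r \<Rightarrow> 'r \<Rightarrow> 'r" and z e :: 'r
    and \<omega> :: nat
  assumes "group_prevariety G"
    and "idem_semiring pl z tm e"
    and "rating_map pl z \<rho>" and "nice \<rho>" and "multiplicative tm e \<rho>"
    and "\<omega> > 0" and "\<forall>r. tm (rpow tm e r \<omega>) (rpow tm e r \<omega>) = rpow tm e r \<omega>"
  shows "SF_complete G pl tm e \<omega> \<rho> (iota G (\<lambda>K. opt_imprint (SF G) pl K \<rho>))
       \<and> (\<forall>S. SF_complete G pl tm e \<omega> \<rho> S \<longrightarrow> iota G (\<lambda>K. opt_imprint (SF G) pl K \<rho>) \<subseteq> S)"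
proof -
  interpret rated_group_based G pl tm z e \<omega> \<rho>
    by unfold_locales (use assms in auto)
  show ?thesis using iota_SF_complete iota_least by blast
qed

end
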